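(* Let $\mathcal{A}$ be a free arrangement in $V=\mathbb{K}^\ell$ with $\exp(\mathcal{A})=(1,d_2,\ldots,d_\ell)$, where $1\le d_2\le\cdots\le d_\ell$, and let $X\in L_k(\mathcal{A})$. Then $\mathcal{A}^X:=\{X\cap H\mid H\in\mathcal{A},\ X\not\subset H\}$ is free with $\exp(\mathcal{A}^X)=(1,d_{k+2},\ldots,d_\ell)$ if and only if $|\mathcal{A}^X|=1+d_{k+2}+\cdots+d_\ell$.
   Context: $\mathbb{K}$ is an arbitrary field, $V=\mathbb{K}^\ell$, $S=\mathbb{K}[x_1,\ldots,x_\ell]$ its coordinate ring, $\operatorname{Der}S=\bigoplus_{i=1}^\ell S\,\partial_{x_i}$. A (hyperplane) arrangement $\mathcal{A}$ in $V$ is a finite set of linear hyperplanes of $V$; for each hyperplane $H$ fix a linear form $\alpha_H\in V^*$ with $\ker\alpha_H=H$. A derivation $\theta\in\operatorname{Der}S$ is homogeneous of degree $d$ if $\theta(\alpha)$ is a homogeneous polynomial of degree $d$ for all $\alpha\in V^*$ with $\theta(\alpha)\ne0$. The logarithmic derivation module is $D(\mathcal{A})=\{\theta\in\operatorname{Der}S\mid \theta(\alpha_H)\in S\alpha_H\ \text{for all }H\in\mathcal{A}\}$. $\mathcal{A}$ is free with exponents $\exp(\mathcal{A})=(d_1,\ldots,d_\ell)$ (a multiset) if $D(\mathcal{A})$ is a free $S$-module with a homogeneous basis $\theta_1,\ldots,\theta_\ell$, $\deg\theta_i=d_i$. The same definitions apply to arrangements in any finite-dimensional $\mathbb{K}$-vector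 space; in particular $\mathcal{A}^X$ is an arrangement in the vector space $X$. $L(\mathcal{A})=\{\bigcap_{H\in\mathcal{B}}H\mid\mathcal{B}\subset\mathcal{A}\}$ (with $V$ the empty intersection) and $L_k(\mathcal{A})=\{X\in L(\mathcal{A})\mid\operatorname{codim}_V X=k\}$. *)

theory Defs
  imports "HOL-Analysis.Analysis" "HOL-Library.Poly_Mapping" "HOL-Library.Multiset"
begin

text \<open>
  A polynomial is a finitely supported function from monomials to coefficients, a monomial being a
  finitely supported exponent function. The type has the variables $x_i$ for all natural numbers
  $i$; the ring in $m$ variables is the subring \<open>poly_ring m\<close>.
\<close>

type_synonym 'a mpoly = "(nat \<Rightarrow>\<^sub>0 nat) \<Rightarrow>\<^sub>0 'a"

definition poly_ring :: "nat \<Rightarrow> 'a::field mpoly set" where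
  "poly_ring m = {p. \<forall>t \<in> Poly_Mapping.keys p. Poly_Mapping.keys t \<subseteq> {..<m}}"

definition const :: "'a::field \<Rightarrow> 'a mpoly" where
  "const c = Poly_Mapping.single 0 c"

definition var :: "nat \<Rightarrow> 'a::field mpoly" where
  "var i = Poly_Mapping.single (Poly_Mapping.single i 1) 1"

text \<open>The zero polynomial is homogeneous of every degree.\<close>

definition homogeneous_poly :: "nat \<Rightarrow> 'a::field mpoly \<Rightarrow> bool" where
  "homogeneous_poly d p \<longleftrightarrow> (\<forall>t \<in> Poly_Mapping.keys p.
     (\<Sum>i \<in> Poly_Mapping.keys t. Poly_Mapping.lookup t i) = d)"

text \<open>If the variable $x_i$ does not occur in \<open>t\<close>, the summand of \<open>t\<close> has coefficient 0.\<close>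

definition partial :: "nat \<Rightarrow> 'a::field mpoly \<Rightarrow> 'a mpoly" where
  "partial i p = (\<Sum>t \<in> Poly_Mapping.keys p.
     Poly_Mapping.single (t - Poly_Mapping.single i 1)
       (of_nat (Poly_Mapping.lookup t i) * Poly_Mapping.lookup p t))"

text \<open>
  The module of derivations of the ring $S$ in $m$ variables is $\bigoplus_{i<m} S\,\partial_{x_i}$.
  Its elements are kept as operators on the whole type of polynomials; such an operator is
  determined by its values on \<open>poly_ring m\<close>, since its coefficients are its values on the
  variables.
\<close>

definition derivations :: "nat \<Rightarrow> ('a::field mpoly \<Rightarrow> 'a mpoly) set" where
  "derivations m =
     {\<theta>. \<exists>f. (\<forall>i<m. f i \<in> poly_ring m) \<and> \<theta> = (\<lambda>p. \<Sum>i<m. f i * partial i p)}"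

definition homogeneous_derivation ::
    "nat \<Rightarrow> nat \<Rightarrow> ('a::field mpoly \<Rightarrow> 'a mpoly) \<Rightarrow> bool" where
  "homogeneous_derivation m d \<theta> \<longleftrightarrow>
     (\<forall>c :: nat \<Rightarrow> 'a. homogeneous_poly d (\<theta> (\<Sum>i<m. const (c i) * var i)))"

text \<open>
  \<open>\<theta> 0, \<dots>, \<theta> (n-1)\<close> is a basis of the submodule \<open>D\<close> over the ring in $m$ variables: a generating
  family that is linearly independent.
\<close>

definition module_basis ::
    "nat \<Rightarrow> ('a::field mpoly \<Rightarrow> 'a mpoly) set \<Rightarrow> nat \<Rightarrow> (nat \<Rightarrow> 'a mpoly \<Rightarrow> 'a mpoly) \<Rightarrow> bool" where
  "module_basis m D n \<theta> \<longleftrightarrow>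
     (\<forall>j<n. \<theta> j \<in> D) \<and>
     (\<forall>\<eta> \<in> D. \<exists>g. (\<forall>j<n. g j \<in> poly_ring m) \<and> \<eta> = (\<lambda>p. \<Sum>j<n. g j * \<theta> j p)) \<and>
     (\<forall>g. (\<forall>j<n. g j \<in> poly_ring m) \<and> (\<lambda>p. \<Sum>j<n. g j * \<theta> j p) = (\<lambda>p. 0)
          \<longrightarrow> (\<forall>j<n. g j = 0))"

text \<open>
  The ambient space of an arrangement is a linear subspace \<open>W\<close> of $\mathbb{K}^n$, which covers both
  $\mathbb{K}^n$ itself (\<open>W = UNIV\<close>) and the elements of the intersection lattice.
\<close>

definition arrangement :: "('a::field ^ 'n) set \<Rightarrow> ('a ^ 'n) set set \<Rightarrow> bool" where
  "arrangement W A \<longleftrightarrow> vec.subspace W \<and> finite A \<and>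
     (\<forall>H \<in> A. vec.subspace H \<and> H \<subseteq> W \<and> vec.dim H + 1 = vec.dim W)"

text \<open>
  For \<open>A\<close> empty the intersection of the hyperplanes is \<open>UNIV\<close>, so this is the lattice of an
  arrangement in the full space.
\<close>

definition intersection_lattice :: "('a::field ^ 'n) set set \<Rightarrow> ('a ^ 'n) set set" where
  "intersection_lattice A = {\<Inter>B | B. B \<subseteq> A}"

definition intersection_lattice_rank ::
    "nat \<Rightarrow> ('a::field ^ 'n) set set \<Rightarrow> ('a ^ 'n) set set" where
  "intersection_lattice_rank k A =
     {X \<in> intersection_lattice A. vec.dim X + k = CARD('n)}"

definition restriction :: "('a::field ^ 'n) set set \<Rightarrow> ('a ^ 'n) set \<Rightarrow> ('a ^ 'n) set set" where
  "restriction A X = {X \<inter> H | H. H \<in> A \<and> \<not> X \<subseteq> H}"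

text \<open>
  A frame is an ordered basis \<open>b\<close> of \<open>W\<close>. It identifies the coordinate ring of \<open>W\<close> with the ring
  in \<open>vec.dim W\<close> variables, where $x_i$ is the coordinate dual to \<open>b i\<close>.
\<close>

definition frame :: "('a::field ^ 'n) set \<Rightarrow> (nat \<Rightarrow> 'a ^ 'n) \<Rightarrow> bool" where
  "frame W b \<longleftrightarrow> inj_on b {..<vec.dim W} \<and> vec.independent (b ` {..<vec.dim W}) \<and>
     vec.span (b ` {..<vec.dim W}) = W"

text \<open>
  The restriction to \<open>W\<close> of the linear form \<open>\<alpha>\<close>, as an element of the coordinate ring of \<open>W\<close>.
  Every linear form on \<open>W\<close> is such a restriction.
\<close>

definition form_poly ::
    "('a::field ^ 'n) set \<Rightarrow> (nat \<Rightarrow> 'a ^ 'n) \<Rightarrow> ('a ^ 'n \<Rightarrow> 'a) \<Rightarrow> 'a mpoly" where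
  "form_poly W b \<alpha> = (\<Sum>i<vec.dim W. const (\<alpha> (b i)) * var i)"

definition defining_form :: "('a::field ^ 'n) set \<Rightarrow> ('a ^ 'n) set \<Rightarrow> ('a ^ 'n \<Rightarrow> 'a) \<Rightarrow> bool" where
  "defining_form W H \<alpha> \<longleftrightarrow>
     Vector_Spaces.linear (\<lambda>c (v :: 'a ^ 'n). c *s v) (*) \<alpha> \<and> {w \<in> W. \<alpha> w = 0} = H"

text \<open>
  Defining forms of the same hyperplane of \<open>W\<close> agree on \<open>W\<close> up to a nonzero scalar, so requiring
  the condition for all of them is the same as requiring it for a fixed one.
\<close>

definition log_derivations ::
    "('a::field ^ 'n) set \<Rightarrow> (nat \<Rightarrow> 'a ^ 'n) \<Rightarrow> ('a ^ 'n) set set \<Rightarrow> ('a mpoly \<Rightarrow> 'a mpoly) set" where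
  "log_derivations W b A =
     {\<theta> \<in> derivations (vec.dim W).
        \<forall>H \<in> A. \<forall>\<alpha>. defining_form W H \<alpha> \<longrightarrow>
          (\<exists>q \<in> poly_ring (vec.dim W). \<theta> (form_poly W b \<alpha>) = q * form_poly W b \<alpha>)}"

text \<open>
  The arrangement \<open>A\<close> in \<open>W\<close> is free and \<open>E\<close> is its multiset of exponents. Two frames of \<open>W\<close> differ by
  a linear change of coordinates, which preserves the condition, so the choice of \<open>b\<close> is immaterial.
\<close>

definition free_with_exponents ::
    "('a::field ^ 'n) set \<Rightarrow> ('a ^ 'n) set set \<Rightarrow> nat multiset \<Rightarrow> bool" where
  "free_with_exponents W A E \<longleftrightarrow>
     (\<exists>b \<theta> d. frame W b \<and>
        module_basis (vec.dim W) (log_derivations W b A) (vec.dim W) \<theta> \<and>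
        (\<forall>j<vec.dim W. homogeneous_derivation (vec.dim W) (d j) (\<theta> j)) \<and>
        E = image_mset d (mset_set {..<vec.dim W}))"

end

theory Submission
  imports Defs "Jordan_Normal_Form.Determinant" "HOL-Library.Function_Algebras"
begin

text \<open>
  A logarithmic derivation of \<open>A\<close> is tangent to \<open>X\<close>, hence restricts to a logarithmic derivation of
  the restriction of \<open>A\<close> to \<open>X\<close>, and the restrictions of a basis span a module of full rank
  $m = \dim X$. So $m$ of them are independent, and since the Euler derivation of \<open>X\<close> is a
  restriction too, one of these may be chosen of degree 1. Their determinant is divisible by the
  product of the defining forms of the restricted arrangement, so its degree is at least the number
  of hyperplanes; on the other hand it is at most 1 plus the sum of the $m - 1$ largest remaining
  exponents. If the number of hyperplanes equals the latter bound, then both inequalities are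
  equalities, the determinant is a constant multiple of the product, and Saito's criterion shows
  that the chosen restrictions form a basis. The converse is the degree formula in Saito's
  criterion.
\<close>

text \<open>The exponents of the restriction must include 1, whereas the \<open>m\<close> largest
  exponents of the arrangement need not. An arbitrary choice of \<open>m\<close> independent
  restrictions would therefore only have its total degree bounded by the sum of the \<open>m\<close>
  largest exponents, which is too weak to meet the number of hyperplanes. Fixing beforehand a
  generator of degree 1 with nonzero restriction, and extending it to a maximal independent family,
  brings the bound down to the one in the statement. Equality then determines the multiset of the
  chosen degrees, though not the chosen indices.

  The field is arbitrary, so no step divides by an integer; the Euler derivation enters only through
  its coefficients, the variables. Unique factorization is not invoked either: linear forms are
  shown to be prime, and every other factor is controlled by its degree or by cancelling one such
  prime after another. The frame of the whole space comes with the freeness and cannot be adapted to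
  \<open>X\<close>, so restriction is expressed through dual functionals.\<close>

section \<open>Monomials and their degrees\<close>

abbreviation mdeg :: "(nat \<Rightarrow>\<^sub>0 nat) \<Rightarrow> nat" where
  "mdeg t \<equiv> (\<Sum>i \<in> Poly_Mapping.keys t. Poly_Mapping.lookup t i)"

lemma mdeg_superset:
  assumes "finite T" "Poly_Mapping.keys t \<subseteq> T"
  shows "mdeg t = (\<Sum>i\<in>T. Poly_Mapping.lookup t i)"
  by (rule sum.mono_neutral_left) (use assms in \<open>auto simp: in_keys_iff\<close>)

lemma mdeg_add: "mdeg (s + t) = mdeg s + mdeg t"
proof -
  let ?T = "Poly_Mapping.keys s \<union> Poly_Mapping.keys t"
  have "mdeg (s + t) = (\<Sum>i\<in>?T. Poly_Mapping.lookup (s + t) i)"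
    by (rule mdeg_superset) (simp_all add: Poly_Mapping.keys_add)
  also have "\<dots> = mdeg s + mdeg t"
    unfolding lookup_add sum.distrib by (simp add: mdeg_superset[of ?T])
  finally show ?thesis .
qed

lemma mdeg_eq_0_iff: "mdeg t = 0 \<longleftrightarrow> t = 0"
proof
  assume "mdeg t = 0"
  then have "Poly_Mapping.lookup t i = 0" for i
    by (cases "i \<in> Poly_Mapping.keys t") (auto simp: in_keys_iff)
  then show "t = 0"
    by (intro poly_mapping_eqI) simp
qed simp

lemma mpoly_sum_single: "p = (\<Sum>t\<in>Poly_Mapping.keys p. Poly_Mapping.single t (Poly_Mapping.lookup p t))"
proof (rule poly_mapping_eqI)
  fix k
  have "Poly_Mapping.lookup (\<Sum>t\<in>Poly_Mapping.keys p. Poly_Mapping.single t (Poly_Mapping.lookup p t)) k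
      = (\<Sum>t\<in>Poly_Mapping.keys p. if t = k then Poly_Mapping.lookup p t else 0)"
    unfolding lookup_sum by (intro sum.cong refl) (simp add: lookup_single when_def)
  also have "\<dots> = Poly_Mapping.lookup p k"
    by (simp add: in_keys_iff)
  finally show "Poly_Mapping.lookup p k =
    Poly_Mapping.lookup (\<Sum>t\<in>Poly_Mapping.keys p. Poly_Mapping.single t (Poly_Mapping.lookup p t)) k" ..
qed

lemma single_eq_0_iff [simp]: "Poly_Mapping.single k v = 0 \<longleftrightarrow> v = 0"
  by (metis lookup_single_eq lookup_zero single_zero)

lemma single_eq_single_iff: "v \<noteq> 0 \<Longrightarrow> Poly_Mapping.single k v = Poly_Mapping.single l v \<longleftrightarrow> k = l"
  by (metis keys_single singleton_inject)

section \<open>Constants and variables\<close>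

lemma const_0 [simp]: "const 0 = 0"
  and const_1 [simp]: "const 1 = 1"
  and const_add: "const (a + b) = const a + const b"
  and const_mult: "const (a * b) = const a * const b"
  and const_uminus: "const (- a) = - const a"
  by (simp_all add: const_def single_add Poly_Mapping.mult_single single_uminus flip: single_one)

lemma const_diff: "const (a - b) = const a - const b"
  using const_add[of a "- b"] by (simp add: const_uminus)

lemma const_sum: "const (sum f I) = (\<Sum>i\<in>I. const (f i))"
  by (induction I rule: infinite_finite_induct) (simp_all add: const_add)

lemma const_eq_0_iff [simp]: "const a = 0 \<longleftrightarrow> a = 0"
  by (simp add: const_def)

lemma lookup_const_mult: "Poly_Mapping.lookup (const a * p) t = a * Poly_Mapping.lookup p t"
proof -
  have "const a * p = (\<Sum>s\<in>Poly_Mapping.keys p. Poly_Mapping.single s (a * Poly_Mapping.lookup p s))"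
    by (subst (1) mpoly_sum_single[of p])
       (simp add: const_def sum_distrib_left Poly_Mapping.mult_single)
  also have "Poly_Mapping.lookup \<dots> t = (\<Sum>s\<in>Poly_Mapping.keys p. if s = t then a * Poly_Mapping.lookup p s else 0)"
    unfolding lookup_sum by (intro sum.cong refl) (simp add: lookup_single when_def)
  finally show ?thesis
    by (simp add: in_keys_iff)
qed

lemma var_neq_0 [simp]: "var i \<noteq> 0"
  by (simp add: var_def)

abbreviation linform :: "nat \<Rightarrow> (nat \<Rightarrow> 'a::field) \<Rightarrow> 'a mpoly" where
  "linform m c \<equiv> (\<Sum>i<m. const (c i) * var i)"

lemma lookup_linform:
  assumes "j < m"
  shows "Poly_Mapping.lookup (linform m c) (Poly_Mapping.single j 1) = c j"
proof -
  have "Poly_Mapping.lookup (linform m c) (Poly_Mapping.single j 1) = (\<Sum>i<m. if i = j then c i else 0)"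
    unfolding lookup_sum lookup_const_mult
    by (intro sum.cong refl) (auto simp: var_def lookup_single when_def single_eq_single_iff)
  then show ?thesis
    using assms by simp
qed

lemma linform_eq_0_iff: "linform m c = 0 \<longleftrightarrow> (\<forall>i<m. c i = 0)"
proof
  assume "linform m c = 0"
  then show "\<forall>i<m. c i = 0"
    by (metis lookup_linform lookup_zero)
qed simp

section \<open>Partial derivatives\<close>

lemma partial_superset:
  assumes "finite T" "Poly_Mapping.keys p \<subseteq> T"
  shows "partial i p = (\<Sum>t \<in> T. Poly_Mapping.single (t - Poly_Mapping.single i 1)
       (of_nat (Poly_Mapping.lookup t i) * Poly_Mapping.lookup p t))"
  unfolding partial_def
  by (rule sum.mono_neutral_left) (use assms in \<open>auto simp: in_keys_iff\<close>)

lemma partial_0 [simp]: "partial i 0 = 0"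
  by (simp add: partial_def)

lemma partial_add: "partial i (p + q) = partial i p + partial i q"
proof -
  let ?T = "Poly_Mapping.keys p \<union> Poly_Mapping.keys q"
  have "Poly_Mapping.keys (p + q) \<subseteq> ?T"
    by (rule Poly_Mapping.keys_add)
  then show ?thesis
    by (simp add: partial_superset[of ?T] sum.distrib lookup_add distrib_left single_add)
qed

lemma partial_sum: "partial i (sum f I) = (\<Sum>j\<in>I. partial i (f j))"
  by (induction I rule: infinite_finite_induct) (simp_all add: partial_add)

lemma const_mult_var: "const c * var j = Poly_Mapping.single (Poly_Mapping.single j 1) c"
  by (simp add: const_def var_def Poly_Mapping.mult_single)

lemma partial_const_var: "partial i (const c * var j) = (if i = j then const c else 0)"
  unfolding const_mult_var
  by (auto simp: partial_def const_def lookup_single when_def)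

lemma partial_linform: "partial i (linform m c) = (if i < m then const (c i) else 0)"
  by (simp add: partial_sum partial_const_var)

section \<open>The polynomial rings in finitely many variables\<close>

lemma poly_ring_0 [simp]: "0 \<in> poly_ring m"
  and poly_ring_const [simp]: "const c \<in> poly_ring m"
  by (simp_all add: poly_ring_def const_def)

lemma poly_ring_1 [simp]: "1 \<in> poly_ring m"
  using poly_ring_const[of 1 m] by simp

lemma poly_ring_var [simp]: "i < m \<Longrightarrow> var i \<in> poly_ring m"
  by (simp add: poly_ring_def var_def)

lemma poly_ring_add: "p \<in> poly_ring m \<Longrightarrow> q \<in> poly_ring m \<Longrightarrow> p + q \<in> poly_ring m"
  using Poly_Mapping.keys_add[of p q] by (fastforce simp: poly_ring_def)

lemma poly_ring_uminus: "p \<in> poly_ring m \<Longrightarrow> - p \<in> poly_ring m"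
  by (simp add: poly_ring_def)

lemma poly_ring_mult:
  assumes "p \<in> poly_ring m" "q \<in> poly_ring m"
  shows "p * q \<in> poly_ring m"
  unfolding poly_ring_def
proof safe
  fix t i assume "t \<in> Poly_Mapping.keys (p * q)" and i: "i \<in> Poly_Mapping.keys t"
  then obtain a b where "t = a + b" "a \<in> Poly_Mapping.keys p" "b \<in> Poly_Mapping.keys q"
    using Poly_Mapping.keys_mult[of p q] by auto
  then show "i < m"
    using assms i Poly_Mapping.keys_add[of a b] unfolding poly_ring_def by blast
qed

lemma poly_ring_sum: "(\<And>i. i \<in> I \<Longrightarrow> f i \<in> poly_ring m) \<Longrightarrow> sum f I \<in> poly_ring m"
  by (induction I rule: infinite_finite_induct) (auto intro: poly_ring_add)

lemma poly_ring_prod: "(\<And>i. i \<in> I \<Longrightarrow> f i \<in> poly_ring m) \<Longrightarrow> prod f I \<in> poly_ring m"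
  by (induction I rule: infinite_finite_induct) (auto intro: poly_ring_mult)

lemma poly_ring_power: "p \<in> poly_ring m \<Longrightarrow> p ^ k \<in> poly_ring m"
  by (induction k) (auto intro: poly_ring_mult)

lemma poly_ring_linform [simp]: "linform m c \<in> poly_ring m"
  by (intro poly_ring_sum poly_ring_mult) auto

section \<open>Substitution homomorphisms\<close>

definition monom_subst :: "(nat \<Rightarrow> 'a::field mpoly) \<Rightarrow> (nat \<Rightarrow>\<^sub>0 nat) \<Rightarrow> 'a mpoly" where
  "monom_subst f t = (\<Prod>i\<in>Poly_Mapping.keys t. f i ^ Poly_Mapping.lookup t i)"

text \<open>This evaluation homomorphism is used three times: to kill the variables outside a ring,
  to eliminate a variable by means of a linear form, and to restrict polynomials to
  \<open>X\<close>.\<close>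

definition subst :: "(nat \<Rightarrow> 'a::field mpoly) \<Rightarrow> 'a mpoly \<Rightarrow> 'a mpoly" where
  "subst f p = (\<Sum>t\<in>Poly_Mapping.keys p. const (Poly_Mapping.lookup p t) * monom_subst f t)"

lemma monom_subst_superset:
  assumes "finite T" "Poly_Mapping.keys t \<subseteq> T"
  shows "monom_subst f t = (\<Prod>i\<in>T. f i ^ Poly_Mapping.lookup t i)"
  unfolding monom_subst_def
  by (rule prod.mono_neutral_left) (use assms in \<open>auto simp: in_keys_iff\<close>)

lemma monom_subst_add: "monom_subst f (s + t) = monom_subst f s * monom_subst f t"
proof -
  let ?T = "Poly_Mapping.keys s \<union> Poly_Mapping.keys t"
  have "monom_subst f (s + t) = (\<Prod>i\<in>?T. f i ^ Poly_Mapping.lookup (s + t) i)"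
    by (rule monom_subst_superset) (simp_all add: Poly_Mapping.keys_add)
  also have "\<dots> = monom_subst f s * monom_subst f t"
    unfolding lookup_add power_add prod.distrib by (simp add: monom_subst_superset[of ?T])
  finally show ?thesis .
qed

lemma subst_superset:
  assumes "finite T" "Poly_Mapping.keys p \<subseteq> T"
  shows "subst f p = (\<Sum>t\<in>T. const (Poly_Mapping.lookup p t) * monom_subst f t)"
  unfolding subst_def
  by (rule sum.mono_neutral_left) (use assms in \<open>auto simp: in_keys_iff\<close>)

lemma subst_0 [simp]: "subst f 0 = 0"
  by (simp add: subst_def)

lemma subst_add: "subst f (p + q) = subst f p + subst f q"
proof -
  let ?T = "Poly_Mapping.keys p \<union> Poly_Mapping.keys q"
  have "Poly_Mapping.keys (p + q) \<subseteq> ?T"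
    by (rule Poly_Mapping.keys_add)
  then show ?thesis
    by (simp add: subst_superset[of ?T] sum.distrib lookup_add distrib_right const_add)
qed

lemma subst_sum: "subst f (sum g I) = (\<Sum>j\<in>I. subst f (g j))"
  by (induction I rule: infinite_finite_induct) (simp_all add: subst_add)

lemma subst_single: "subst f (Poly_Mapping.single t c) = const c * monom_subst f t"
  by (simp add: subst_def)

lemma subst_mult: "subst f (p * q) = subst f p * subst f q"
proof -
  let ?P = "Poly_Mapping.keys p" and ?Q = "Poly_Mapping.keys q"
  have "p * q = (\<Sum>s\<in>?P. \<Sum>t\<in>?Q. Poly_Mapping.single s (Poly_Mapping.lookup p s) *
      Poly_Mapping.single t (Poly_Mapping.lookup q t))"
    by (subst mpoly_sum_single[of p], subst mpoly_sum_single[of q]) (rule sum_product)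
  then have "subst f (p * q) = subst f (\<Sum>s\<in>?P. \<Sum>t\<in>?Q. Poly_Mapping.single s (Poly_Mapping.lookup p s) *
      Poly_Mapping.single t (Poly_Mapping.lookup q t))"
    by (rule arg_cong)
  also have "\<dots> = (\<Sum>s\<in>?P. \<Sum>t\<in>?Q. (const (Poly_Mapping.lookup p s) * monom_subst f s) *
      (const (Poly_Mapping.lookup q t) * monom_subst f t))"
    unfolding subst_sum Poly_Mapping.mult_single subst_single const_mult monom_subst_add
    by (intro sum.cong refl) (simp only: mult_ac)
  also have "\<dots> = subst f p * subst f q"
    by (simp add: subst_def sum_product)
  finally show ?thesis .
qed

lemma subst_const [simp]: "subst f (const c) = const c"
  by (simp add: const_def subst_single monom_subst_def)

lemma subst_1 [simp]: "subst f 1 = 1"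
  using subst_const[of f 1] by simp

lemma subst_var [simp]: "subst f (var i) = f i"
  by (simp add: var_def subst_single monom_subst_def)

lemma subst_prod: "subst f (prod g I) = (\<Prod>j\<in>I. subst f (g j))"
  by (induction I rule: infinite_finite_induct) (simp_all add: subst_mult)

lemma subst_linform: "subst f (linform m c) = (\<Sum>i<m. const (c i) * f i)"
  by (simp add: subst_sum subst_mult)

lemma subst_poly_ring:
  assumes p: "p \<in> poly_ring n" and f: "\<And>i. i < n \<Longrightarrow> f i \<in> poly_ring m"
  shows "subst f p \<in> poly_ring m"
  unfolding subst_def monom_subst_def
proof (intro poly_ring_sum poly_ring_mult poly_ring_const poly_ring_prod poly_ring_power f)
  fix t i assume "t \<in> Poly_Mapping.keys p" "i \<in> Poly_Mapping.keys t"
  then show "i < n"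
    using p by (auto simp: poly_ring_def)
qed

lemma subst_cong_poly_ring:
  assumes p: "p \<in> poly_ring n" and f: "\<And>i. i < n \<Longrightarrow> f i = g i"
  shows "subst f p = subst g p"
  unfolding subst_def monom_subst_def
  by (intro sum.cong prod.cong refl arg_cong2[of _ _ _ _ times] arg_cong2[of _ _ _ _ power])
     (use assms in \<open>auto simp: poly_ring_def\<close>)

lemma monom_subst_var: "monom_subst var t = (Poly_Mapping.single t 1 :: 'a::field mpoly)"
proof -
  have pow: "var i ^ k = (Poly_Mapping.single (Poly_Mapping.single i k) 1 :: 'a mpoly)" for i k
    by (induction k) (simp_all add: var_def Poly_Mapping.mult_single flip: single_add)
  have "(\<Prod>i\<in>I. var i ^ Poly_Mapping.lookup t i) =
      (Poly_Mapping.single (\<Sum>i\<in>I. Poly_Mapping.single i (Poly_Mapping.lookup t i)) 1 :: 'a mpoly)" for I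
    by (induction I rule: infinite_finite_induct) (simp_all add: pow Poly_Mapping.mult_single)
  then show ?thesis
    unfolding monom_subst_def using mpoly_sum_single[of t] by metis
qed

lemma subst_id: "subst var p = p"
  unfolding subst_def monom_subst_var
  by (subst (3) mpoly_sum_single) (simp add: const_def Poly_Mapping.mult_single)

text \<open>A quotient found in the full type could a priori involve further variables. Sending
  those to zero fixes \<open>a\<close> and \<open>p\<close> and moves the quotient into the
  ring.\<close>

lemma poly_ring_dvdE:
  assumes "a dvd p" "a \<in> poly_ring m" "p \<in> poly_ring m"
  obtains q where "q \<in> poly_ring m" "p = q * a"
proof -
  obtain r where r: "p = r * a"
    using assms(1) by (metis dvd_def mult.commute)
  define f where "f i = (if i < m then var i else 0 :: 'a mpoly)" for i
  have *: "subst f p = p" "subst f a = a"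
    using assms(2,3) subst_cong_poly_ring[of _ m f var] by (auto simp: f_def subst_id)
  then have "p = subst f r * a"
    using subst_mult[of f r a] by (simp only: r[symmetric] *)
  moreover have "subst f r \<in> poly_ring m"
    unfolding subst_def monom_subst_def
    by (intro poly_ring_sum poly_ring_mult poly_ring_const poly_ring_prod poly_ring_power)
       (auto simp: f_def)
  ultimately show thesis
    using that by blast
qed

text \<open>Modulo \<open>a\<close> the substitution fixes every variable, hence every polynomial:
  differences of powers factor, and a difference of products telescopes.\<close>

lemma subst_diff_dvd:
  assumes "\<And>i. a dvd var i - f i"
  shows "a dvd p - subst f p"
proof -
  have pow: "a dvd var i ^ k - f i ^ k" for i k
    unfolding power_diff_sumr2 by (rule dvd_mult2[OF assms])
  have prod: "a dvd (\<Prod>i\<in>I. var i ^ Poly_Mapping.lookup t i) - (\<Prod>i\<in>I. f i ^ Poly_Mapping.lookup t i)" for I t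
  proof (induction I rule: infinite_finite_induct)
    case (insert j I)
    let ?x = "var j ^ Poly_Mapping.lookup t j" and ?y = "f j ^ Poly_Mapping.lookup t j"
    let ?X = "\<Prod>i\<in>I. var i ^ Poly_Mapping.lookup t i" and ?Y = "\<Prod>i\<in>I. f i ^ Poly_Mapping.lookup t i"
    have "?x * ?X - ?y * ?Y = ?x * (?X - ?Y) + (?x - ?y) * ?Y"
      by (simp add: algebra_simps)
    moreover have "a dvd ?x * (?X - ?Y) + (?x - ?y) * ?Y"
      by (intro dvd_add dvd_mult dvd_mult2 pow insert.IH)
    ultimately show ?case
      using insert.hyps by simp
  qed auto
  have "p - subst f p = subst var p - subst f p"
    by (simp add: subst_id)
  also have "\<dots> = (\<Sum>t\<in>Poly_Mapping.keys p. const (Poly_Mapping.lookup p t) * (monom_subst var t - monom_subst f t))"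
    unfolding subst_def sum_subtractf right_diff_distrib ..
  finally show ?thesis
    using prod by (auto simp: monom_subst_def intro!: dvd_sum dvd_mult)
qed

section \<open>Linear forms are prime\<close>

text \<open>Solving a nonzero linear form for one of its variables gives a substitution whose kernel is
  the ideal generated by the form.\<close>

lemma linform_dvd_multD:
  assumes "j < m" "c j \<noteq> 0" and dvd: "linform m c dvd p * q"
  shows "linform m c dvd p \<or> linform m c dvd q"
proof -
  let ?l = "linform m c"
  define f where "f = var(j := var j - const (inverse (c j)) * ?l)"
  have f: "?l dvd var i - f i" for i
    by (simp add: f_def)
  have split: "?l = const (c j) * var j + (\<Sum>i\<in>{..<m} - {j}. const (c i) * var i)"
    using assms(1) by (simp add: sum.remove)
  have "subst f ?l = const (c j) * f j + (\<Sum>i\<in>{..<m} - {j}. const (c i) * f i)"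
    unfolding subst_linform using assms(1) by (simp add: sum.remove)
  also have "(\<Sum>i\<in>{..<m} - {j}. const (c i) * f i) = (\<Sum>i\<in>{..<m} - {j}. const (c i) * var i)"
    by (intro sum.cong) (auto simp: f_def)
  also have "const (c j) * f j = const (c j) * var j - const (c j * inverse (c j)) * ?l"
    by (simp add: f_def algebra_simps const_mult)
  finally have ker: "subst f ?l = 0"
    using assms(2) split by simp
  have iff: "?l dvd r \<longleftrightarrow> subst f r = 0" for r
  proof
    assume "?l dvd r"
    then obtain s where "r = ?l * s" ..
    then show "subst f r = 0"
      by (simp add: subst_mult ker)
  next
    assume "subst f r = 0"
    then show "?l dvd r"
      using subst_diff_dvd[of ?l f r] f by simp
  qed
  show ?thesis
    using dvd unfolding iff subst_mult by simp
qed

section \<open>Homogeneity\<close>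

text \<open>Unlike homogeneity, a lower bound on the degrees of the monomials passes to arbitrary
  multiples. This gives degree comparisons from divisibility when nothing is known about the
  cofactor.\<close>

definition order_ge :: "nat \<Rightarrow> 'a::field mpoly \<Rightarrow> bool" where
  "order_ge k p \<longleftrightarrow> (\<forall>t \<in> Poly_Mapping.keys p. k \<le> mdeg t)"

lemma order_ge_0 [simp]: "order_ge k 0"
  and order_ge_zero [simp]: "order_ge 0 p"
  by (simp_all add: order_ge_def)

lemma order_ge_mono: "order_ge b p \<Longrightarrow> a \<le> b \<Longrightarrow> order_ge a p"
  by (auto simp: order_ge_def)

lemma order_ge_add: "order_ge k p \<Longrightarrow> order_ge k q \<Longrightarrow> order_ge k (p + q)"
  using Poly_Mapping.keys_add[of p q] unfolding order_ge_def by blast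

lemma order_ge_sum: "(\<And>i. i \<in> I \<Longrightarrow> order_ge k (f i)) \<Longrightarrow> order_ge k (sum f I)"
  by (induction I rule: infinite_finite_induct) (auto intro: order_ge_add)

lemma order_ge_mult:
  assumes "order_ge a p" "order_ge b q"
  shows "order_ge (a + b) (p * q)"
  unfolding order_ge_def
proof
  fix t assume "t \<in> Poly_Mapping.keys (p * q)"
  then obtain r s where "t = r + s" "r \<in> Poly_Mapping.keys p" "s \<in> Poly_Mapping.keys q"
    using Poly_Mapping.keys_mult[of p q] by auto
  then show "a + b \<le> mdeg t"
    using assms unfolding order_ge_def by (simp only: mdeg_add add_mono)
qed

lemma homogeneous_0 [simp]: "homogeneous_poly d 0"
  by (simp add: homogeneous_poly_def)

lemma homogeneous_const [simp]: "homogeneous_poly 0 (const c)"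
  by (simp add: homogeneous_poly_def const_def)

lemma homogeneous_1 [simp]: "homogeneous_poly 0 1"
  using homogeneous_const[of 1] by simp

lemma homogeneous_var [simp]: "homogeneous_poly 1 (var i)"
  by (simp add: homogeneous_poly_def var_def)

lemma homogeneous_add: "homogeneous_poly d p \<Longrightarrow> homogeneous_poly d q \<Longrightarrow> homogeneous_poly d (p + q)"
  using Poly_Mapping.keys_add[of p q] unfolding homogeneous_poly_def by blast

lemma homogeneous_uminus: "homogeneous_poly d p \<Longrightarrow> homogeneous_poly d (- p)"
  by (simp add: homogeneous_poly_def)

lemma homogeneous_diff: "homogeneous_poly d p \<Longrightarrow> homogeneous_poly d q \<Longrightarrow> homogeneous_poly d (p - q)"
  using homogeneous_add[of d p "- q"] by (simp add: homogeneous_uminus)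

lemma homogeneous_sum: "(\<And>i. i \<in> I \<Longrightarrow> homogeneous_poly d (f i)) \<Longrightarrow> homogeneous_poly d (sum f I)"
  by (induction I rule: infinite_finite_induct) (auto intro: homogeneous_add)

lemma homogeneous_mult:
  assumes "homogeneous_poly a p" "homogeneous_poly b q"
  shows "homogeneous_poly (a + b) (p * q)"
  unfolding homogeneous_poly_def
proof
  fix t assume "t \<in> Poly_Mapping.keys (p * q)"
  then obtain r s where "t = r + s" "r \<in> Poly_Mapping.keys p" "s \<in> Poly_Mapping.keys q"
    using Poly_Mapping.keys_mult[of p q] by auto
  then show "mdeg t = a + b"
    using assms unfolding homogeneous_poly_def by (simp only: mdeg_add)
qed

lemma homogeneous_prod:
  "(\<And>i. i \<in> I \<Longrightarrow> homogeneous_poly (e i) (f i)) \<Longrightarrow> homogeneous_poly (sum e I) (prod f I)"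
  by (induction I rule: infinite_finite_induct) (auto intro: homogeneous_mult)

lemma homogeneous_power: "homogeneous_poly d p \<Longrightarrow> homogeneous_poly (k * d) (p ^ k)"
  by (induction k) (auto intro: homogeneous_mult)

lemma homogeneous_const_mult: "homogeneous_poly d p \<Longrightarrow> homogeneous_poly d (const c * p)"
  using homogeneous_mult[OF homogeneous_const, of d p c] by simp

lemma homogeneous_linform [simp]: "homogeneous_poly 1 (linform m c)"
  by (intro homogeneous_sum homogeneous_const_mult homogeneous_var)

lemma homogeneous_subst:
  assumes p: "homogeneous_poly d p" and f: "\<And>i. homogeneous_poly 1 (f i)"
  shows "homogeneous_poly d (subst f p)"
  unfolding subst_def
proof (intro homogeneous_sum homogeneous_const_mult)
  fix t assume t: "t \<in> Poly_Mapping.keys p"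
  have "homogeneous_poly (\<Sum>i\<in>Poly_Mapping.keys t. Poly_Mapping.lookup t i * 1) (monom_subst f t)"
    unfolding monom_subst_def by (intro homogeneous_prod homogeneous_power f)
  then show "homogeneous_poly d (monom_subst f t)"
    using p t by (simp add: homogeneous_poly_def)
qed

lemma homogeneous_imp_order_ge: "homogeneous_poly d p \<Longrightarrow> order_ge d p"
  by (simp add: homogeneous_poly_def order_ge_def)

lemma homogeneous_order_ge_le:
  assumes "homogeneous_poly d p" "order_ge k p" "p \<noteq> 0"
  shows "k \<le> d"
proof -
  obtain t where "t \<in> Poly_Mapping.keys p"
    using assms(3) by (metis ex_in_conv keys_eq_empty)
  then show ?thesis
    using assms(1,2) by (auto simp: homogeneous_poly_def order_ge_def)
qed

lemma homogeneous_dvd_le: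
  assumes "homogeneous_poly a p" "homogeneous_poly b q" "q \<noteq> 0" "p dvd q"
  shows "a \<le> b"
proof -
  obtain u where "q = p * u"
    using assms(4) ..
  then have "order_ge a q"
    using order_ge_mult[OF homogeneous_imp_order_ge[OF assms(1)], of 0 u] by simp
  then show ?thesis
    using homogeneous_order_ge_le assms(2,3) by blast
qed

text \<open>Only the constant term of the cofactor can contribute in degree \<open>d\<close>; the
  rest gives a polynomial that is homogeneous of degree \<open>d\<close> and of order at least
  \<open>d + 1\<close>, hence zero.\<close>

lemma homogeneous_dvd_imp_const_mult:
  assumes p: "homogeneous_poly d p" and q: "homogeneous_poly d q" "q \<noteq> 0" and "p dvd q"
  obtains c where "c \<noteq> 0" "q = const c * p"
proof -
  obtain u where u: "q = p * u"
    using assms(4) ..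
  define c where "c = Poly_Mapping.lookup u 0"
  have "order_ge 1 (u - const c)"
    unfolding order_ge_def
  proof
    fix t assume "t \<in> Poly_Mapping.keys (u - const c)"
    then have "t \<noteq> 0"
      by (auto simp: in_keys_iff lookup_minus c_def const_def)
    then show "1 \<le> mdeg t"
      using mdeg_eq_0_iff[of t] by linarith
  qed
  then have "order_ge (d + 1) (p * (u - const c))"
    by (rule order_ge_mult[OF homogeneous_imp_order_ge[OF p]])
  moreover have eq: "p * (u - const c) = q - const c * p"
    by (simp add: u algebra_simps)
  moreover have "homogeneous_poly d (q - const c * p)"
    by (intro homogeneous_diff homogeneous_const_mult p q)
  ultimately have "q - const c * p = 0"
    using homogeneous_order_ge_le[of d "q - const c * p" "d + 1"] by auto
  then show thesis
    using that[of c] q(2) by auto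
qed

lemma linform_dvd_linformD:
  assumes "linform m a dvd linform m b" "\<exists>i<m. b i \<noteq> 0"
  obtains c where "c \<noteq> 0" "\<And>i. i < m \<Longrightarrow> b i = c * a i"
proof -
  have "linform m b \<noteq> 0"
    using assms(2) unfolding linform_eq_0_iff by simp
  then obtain c where c: "c \<noteq> 0" "linform m b = const c * linform m a"
    using homogeneous_dvd_imp_const_mult[of 1 "linform m a" "linform m b"] assms(1) homogeneous_linform
    by blast
  have "b i = c * a i" if "i < m" for i
    using arg_cong[OF c(2), of "\<lambda>p. Poly_Mapping.lookup p (Poly_Mapping.single i 1)"]
    unfolding lookup_const_mult lookup_linform[OF that] .
  then show thesis
    using that c(1) by blast
qed

section \<open>Determinants of families\<close>

text \<open>With rows as functions, a family of coefficient vectors is itself the argument, and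
  replacing a row is the update \<open>M(i := v)\<close>.\<close>

definition detf :: "nat \<Rightarrow> (nat \<Rightarrow> nat \<Rightarrow> 'b::comm_ring_1) \<Rightarrow> 'b" where
  "detf m M = Determinant.det (Matrix.mat m m (\<lambda>(i, j). M i j))"

lemma detf_expand:
  "detf m M = (\<Sum>p | p permutes {0..<m}. signof p * (\<Prod>i = 0..<m. M i (p i)))"
  unfolding detf_def
  by (subst det_def'[of _ m]) (auto intro!: sum.cong arg_cong2[of _ _ _ _ times] prod.cong simp: permutes_in_image)

lemma detf_mult:
  "detf m (\<lambda>i j. \<Sum>k<m. G i k * M k j) = detf m G * detf m M"
proof -
  have "Matrix.mat m m (\<lambda>(i, j). \<Sum>k<m. G i k * M k j) =
      Matrix.mat m m (\<lambda>(i, j). G i j) * Matrix.mat m m (\<lambda>(i, j). M i j)"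
    by (rule eq_matI) (auto simp: scalar_prod_def atLeast0LessThan)
  then show ?thesis
    unfolding detf_def by (simp add: det_mult[of _ m])
qed

lemma detf_diag:
  "detf m (\<lambda>i j. if i = j then e i else 0) = (\<Prod>i<m. e i)"
  unfolding detf_def
  by (subst det_upper_triangular[of _ m])
     (auto simp: upper_triangular_def diag_mat_def prod.list_conv_set_nth atLeast0LessThan)

lemma detf_cong:
  "(\<And>i j. i < m \<Longrightarrow> j < m \<Longrightarrow> M i j = N i j) \<Longrightarrow> detf m M = detf m N"
  unfolding detf_def by (intro arg_cong[of _ _ Determinant.det] eq_matI) auto

text \<open>\<open>C\<close> is the adjugate. The second property holds because the cofactors along
  row \<open>i\<close> do not involve that row, so they are unchanged when it is replaced by
  \<open>v\<close>.\<close>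

lemma detf_adjugate:
  obtains C where "\<And>i j. i < m \<Longrightarrow> j < m \<Longrightarrow> (\<Sum>k<m. C i k * M k j) = (if i = j then detf m M else 0)"
    and "\<And>i v. i < m \<Longrightarrow> (\<Sum>j<m. v j * C j i) = detf m (M(i := v))"
proof -
  let ?A = "Matrix.mat m m (\<lambda>(i, j). M i j)"
  define C where "C i k = adj_mat ?A $$ (i, k)" for i k
  have A: "?A \<in> carrier_mat m m"
    by simp
  note adj = adj_mat[OF A]
  have "(\<Sum>k<m. C i k * M k j) = (if i = j then detf m M else 0)" if ij: "i < m" "j < m" for i j
  proof -
    have "(\<Sum>k<m. C i k * M k j) = (adj_mat ?A * ?A) $$ (i, j)"
      using adj(1) ij by (auto simp: scalar_prod_def C_def atLeast0LessThan)
    then show ?thesis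
      using ij by (simp add: adj(3) detf_def)
  qed
  moreover have "(\<Sum>j<m. v j * C j i) = detf m (M(i := v))" if i: "i < m" for i v
  proof -
    let ?B = "Matrix.mat m m (\<lambda>(k, j). (M(i := v)) k j)"
    have "detf m (M(i := v)) = (\<Sum>j<m. ?B $$ (i, j) * cofactor ?B i j)"
      unfolding detf_def by (rule laplace_expansion_row) (use i in auto)
    also have "\<dots> = (\<Sum>j<m. v j * C j i)"
    proof (intro sum.cong refl)
      fix j assume j: "j \<in> {..<m}"
      have "mat_delete ?B i j = mat_delete ?A i j"
        unfolding mat_delete_def by (rule eq_matI) (use i j in auto)
      then show "?B $$ (i, j) * cofactor ?B i j = v j * C j i"
        using i j by (simp add: C_def adj_mat_def cofactor_def)
    qed
    finally show ?thesis ..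
  qed
  ultimately show thesis
    using that by blast
qed

text \<open>Cramer's rule without division: \<open>v\<close> times the adjugate times
  \<open>M\<close>, computed in two ways.\<close>

lemma detf_cramer:
  assumes "j < m"
  shows "detf m M * v j = (\<Sum>k<m. detf m (M(k := v)) * M k j)"
proof -
  obtain C where C: "\<And>i j. i < m \<Longrightarrow> j < m \<Longrightarrow> (\<Sum>k<m. C i k * M k j) = (if i = j then detf m M else 0)"
    "\<And>i v. i < m \<Longrightarrow> (\<Sum>j<m. v j * C j i) = detf m (M(i := v))"
    by (rule detf_adjugate[where M = M and m = m]) blast
  have "(\<Sum>k<m. detf m (M(k := v)) * M k j) = (\<Sum>k<m. (\<Sum>i<m. v i * C i k) * M k j)"
    by (intro sum.cong refl) (simp add: C(2))
  also have "\<dots> = (\<Sum>i<m. \<Sum>k<m. v i * C i k * M k j)"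
    unfolding sum_distrib_right by (rule sum.swap)
  also have "\<dots> = (\<Sum>i<m. v i * (if i = j then detf m M else 0))"
    using assms by (intro sum.cong refl) (simp add: mult.assoc C(1) flip: sum_distrib_left)
  also have "\<dots> = detf m M * v j"
    using assms by (simp add: if_distrib mult.commute cong: if_cong)
  finally show ?thesis ..
qed

text \<open>The adjugate carries the column \<open>M c\<close>, all of whose entries are multiples
  of \<open>a\<close>, to \<open>detf m M\<close> times \<open>c\<close>. With \<open>c\<close> the
  coefficients of a linear form, this makes the form divide the determinant.\<close>

lemma dvd_detf_mult:
  assumes "\<And>i. i < m \<Longrightarrow> a dvd (\<Sum>j<m. M i j * c j)" "j < m"
  shows "a dvd detf m M * c j"
proof -
  obtain C where C: "\<And>i j. i < m \<Longrightarrow> j < m \<Longrightarrow> (\<Sum>k<m. C i k * M k j) = (if i = j then detf m M else 0)"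
    by (rule detf_adjugate[where M = M and m = m]) blast
  have "(\<Sum>k<m. C j k * (\<Sum>l<m. M k l * c l)) = (\<Sum>l<m. \<Sum>k<m. C j k * M k l * c l)"
    unfolding sum_distrib_left by (subst sum.swap) (simp add: mult.assoc)
  also have "\<dots> = (\<Sum>l<m. (if j = l then detf m M else 0) * c l)"
    using assms(2) by (intro sum.cong refl) (simp add: C flip: sum_distrib_right)
  also have "\<dots> = (\<Sum>l<m. if j = l then detf m M * c l else 0)"
    by (intro sum.cong refl) simp
  also have "\<dots> = detf m M * c j"
    using assms(2) by simp
  finally have "detf m M * c j = (\<Sum>k<m. C j k * (\<Sum>l<m. M k l * c l))" ..
  moreover have "a dvd (\<Sum>k<m. C j k * (\<Sum>l<m. M k l * c l))"
    by (intro dvd_sum dvd_mult assms(1)) simp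
  ultimately show ?thesis
    by simp
qed

lemma detf_eq_0D:
  fixes M :: "nat \<Rightarrow> nat \<Rightarrow> 'b::idom"
  assumes "detf m M = 0"
  obtains v i where "i < m" "v i \<noteq> 0" "\<And>j. j < m \<Longrightarrow> (\<Sum>i<m. v i * M i j) = 0"
proof -
  let ?A = "Matrix.mat m m (\<lambda>(i, j). M i j)"
  have "Determinant.det (transpose_mat ?A) = 0"
    using assms det_transpose[of ?A m] by (simp add: detf_def)
  then obtain w where w: "w \<in> carrier_vec m" "w \<noteq> 0\<^sub>v m" "transpose_mat ?A *\<^sub>v w = 0\<^sub>v m"
    using det_0_iff_vec_prod_zero[of "transpose_mat ?A" m] by auto
  then obtain i where "i < m" "vec_index w i \<noteq> 0"
    by (metis carrier_vecD eq_vecI index_zero_vec(1,2))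
  moreover have "(\<Sum>i<m. vec_index w i * M i j) = 0" if "j < m" for j
  proof -
    have "vec_index (transpose_mat ?A *\<^sub>v w) j = (\<Sum>i<m. vec_index w i * M i j)"
      using that w(1) by (auto simp: scalar_prod_def atLeast0LessThan mult.commute intro!: sum.cong)
    then show ?thesis
      using w(3) that by simp
  qed
  ultimately show thesis
    using that[of i "\<lambda>i. vec_index w i"] by blast
qed

lemma signof_const: "signof p = const (signof p)"
  by (simp add: sign_def const_uminus)

lemma detf_homogeneous:
  assumes "\<And>i j. i < m \<Longrightarrow> j < m \<Longrightarrow> homogeneous_poly (e i) (M i j)"
  shows "homogeneous_poly (\<Sum>i<m. e i) (detf m M)"
  unfolding detf_expand
proof (rule homogeneous_sum)
  fix p assume "p \<in> {p. p permutes {0..<m}}"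
  then have "homogeneous_poly (\<Sum>i = 0..<m. e i) (\<Prod>i = 0..<m. M i (p i))"
    by (intro homogeneous_prod assms) (auto simp: permutes_in_image)
  then show "homogeneous_poly (\<Sum>i<m. e i) (signof p * (\<Prod>i = 0..<m. M i (p i)))"
    by (subst signof_const) (simp add: homogeneous_const_mult atLeast0LessThan)
qed

lemma detf_poly_ring:
  assumes "\<And>i j. i < m \<Longrightarrow> j < m \<Longrightarrow> M i j \<in> poly_ring n"
  shows "detf m M \<in> poly_ring n"
  unfolding detf_expand
proof (intro poly_ring_sum poly_ring_mult poly_ring_prod)
  fix p assume "p \<in> {p. p permutes {0..<m}}"
  then show "signof p \<in> (poly_ring n :: 'a mpoly set)"
    by (subst signof_const) simp
next
  fix p i assume "p \<in> {p. p permutes {0..<m}}" "i \<in> {0..<m}"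
  then show "M i (p i) \<in> poly_ring n"
    by (intro assms) (auto simp: permutes_in_image)
qed

lemma detf_neq_0_independent:
  fixes M :: "nat \<Rightarrow> nat \<Rightarrow> 'b::idom"
  assumes "detf m M \<noteq> 0" "\<And>j. j < m \<Longrightarrow> (\<Sum>i<m. v i * M i j) = 0" "i < m"
  shows "v i = 0"
proof -
  let ?A = "transpose_mat (Matrix.mat m m (\<lambda>(i, j). M i j))" and ?v = "Matrix.vec m v"
  have A: "?A \<in> carrier_mat m m"
    by simp
  have "?A *\<^sub>v ?v = 0\<^sub>v m"
    using assms(2) by (intro eq_vecI) (simp_all add: scalar_prod_def atLeast0LessThan mult.commute)
  moreover have "Determinant.det ?A \<noteq> 0"
    using assms(1) det_transpose[of "Matrix.mat m m (\<lambda>(i, j). M i j)" m] by (simp add: detf_def)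
  ultimately have "?v = 0\<^sub>v m"
    using det_0_iff_vec_prod_zero[of ?A m] vec_carrier[of m v] A by blast
  then have "vec_index ?v i = vec_index (0\<^sub>v m) i"
    by (rule arg_cong)
  then show ?thesis
    using assms(3) by simp
qed

section \<open>Cancellation of prime factors\<close>

text \<open>Each \<open>p j\<close> divides \<open>u * v\<close> but not \<open>u\<close>, so it
  divides the cofactor \<open>v\<close> and cancels. This replaces an appeal to unique
  factorization.\<close>

lemma dvd_mult_prod_primeD:
  fixes u :: "'b::idom"
  assumes "finite I" "\<And>i. i \<in> I \<Longrightarrow> prime_elem (p i)" "\<And>i. i \<in> I \<Longrightarrow> \<not> p i dvd u"
    and "u dvd q * (\<Prod>i\<in>I. p i)"
  shows "u dvd q"
  using assms
proof (induction I rule: finite_induct)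
  case (insert j I)
  obtain v where v: "q * (\<Prod>i\<in>insert j I. p i) = u * v"
    using insert.prems(3) ..
  have eq: "p j * (q * (\<Prod>i\<in>I. p i)) = u * v"
    using v insert.hyps by (simp add: mult_ac)
  then have "p j dvd u * v"
    unfolding eq[symmetric] by simp
  then have "p j dvd v"
    using insert.prems(1,2) by (simp add: prime_elem_dvd_mult_iff)
  then obtain w where "v = p j * w" ..
  then have "p j * (q * (\<Prod>i\<in>I. p i)) = p j * (u * w)"
    using eq by (simp add: mult_ac)
  moreover have "p j \<noteq> 0"
    using insert.prems(1)[of j] by (simp add: prime_elem_def)
  ultimately have "u dvd q * (\<Prod>i\<in>I. p i)"
    by simp
  then show ?case
    using insert by auto
qed simp

lemma prime_elem_dvd_prodD:
  fixes p :: "'b::comm_semiring_1"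
  assumes "finite I" "prime_elem p" "p dvd (\<Prod>i\<in>I. f i)"
  shows "\<exists>i\<in>I. p dvd f i"
  using assms
proof (induction I rule: finite_induct)
  case empty
  then show ?case
    by (simp add: prime_elem_def)
next
  case (insert i I)
  then show ?case
    by (auto dest: prime_elem_dvd_multD)
qed

section \<open>Saito's criterion\<close>

text \<open>The coefficient vectors of logarithmic derivations: by \<open>deriv_op_linform\<close>
  the sum is the value of the derivation on the linear form of \<open>H\<close>. Plain divisibility
  suffices, as \<open>poly_ring_dvdE\<close> puts the quotient into the ring.\<close>

definition logvec :: "nat \<Rightarrow> 'h set \<Rightarrow> ('h \<Rightarrow> nat \<Rightarrow> 'a::field) \<Rightarrow> (nat \<Rightarrow> 'a mpoly) \<Rightarrow> bool" where
  "logvec m A c f \<longleftrightarrow> (\<forall>i<m. f i \<in> poly_ring m) \<and>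
     (\<forall>H\<in>A. linform m (c H) dvd (\<Sum>j<m. const (c H j) * f j))"

text \<open>The hyperplanes are mere labels here, so the results apply to the arrangement and to its
  restriction alike. Pairwise non-proportionality is stated as non-divisibility, which is how it is
  used with primes.\<close>

locale linear_forms =
  fixes m :: nat and A :: "'h set" and c :: "'h \<Rightarrow> nat \<Rightarrow> 'a::field"
  assumes finite: "finite A"
    and nonzero: "H \<in> A \<Longrightarrow> \<exists>j<m. c H j \<noteq> 0"
    and dvd_imp_eq: "H \<in> A \<Longrightarrow> H' \<in> A \<Longrightarrow> linform m (c H) dvd linform m (c H') \<Longrightarrow> H = H'"
begin

abbreviation Q :: "'a mpoly" where
  "Q \<equiv> (\<Prod>H\<in>A. linform m (c H))"

lemma linform_neq_0: "H \<in> A \<Longrightarrow> linform m (c H) \<noteq> 0"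
  using nonzero by (simp add: linform_eq_0_iff)

lemma prime_linform:
  assumes "H \<in> A"
  shows "prime_elem (linform m (c H))"
proof (rule prime_elemI)
  show "\<not> linform m (c H) dvd 1"
  proof
    assume "linform m (c H) dvd 1"
    then have "1 \<le> (0::nat)"
      by (rule homogeneous_dvd_le[OF homogeneous_linform homogeneous_1, rotated]) simp
    then show False
      by simp
  qed
next
  fix p q assume "linform m (c H) dvd p * q"
  then show "linform m (c H) dvd p \<or> linform m (c H) dvd q"
    using nonzero[OF assms] linform_dvd_multD by blast
qed (use assms linform_neq_0 in auto)

lemma not_linform_dvd_prod:
  assumes "H \<in> A" "B \<subseteq> A" "H \<notin> B"
  shows "\<not> linform m (c H) dvd (\<Prod>H'\<in>B. linform m (c H'))"
proof
  assume "linform m (c H) dvd (\<Prod>H'\<in>B. linform m (c H'))"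
  then obtain H' where "H' \<in> B" "linform m (c H) dvd linform m (c H')"
    using prime_elem_dvd_prodD[OF finite_subset[OF assms(2) finite] prime_linform[OF assms(1)]]
    by blast
  then show False
    using dvd_imp_eq assms by blast
qed

text \<open>The forms are pairwise non-associated primes, so a further form, dividing no product of
  the earlier ones, must divide the remaining cofactor.\<close>

lemma prod_linform_dvd:
  assumes "B \<subseteq> A" "\<And>H. H \<in> B \<Longrightarrow> linform m (c H) dvd p"
  shows "(\<Prod>H\<in>B. linform m (c H)) dvd p"
  using finite_subset[OF assms(1) finite] assms
proof (induction B rule: finite_induct)
  case (insert H B)
  then obtain r where r: "p = (\<Prod>H\<in>B. linform m (c H)) * r"
    by auto
  have "linform m (c H) dvd (\<Prod>H\<in>B. linform m (c H)) * r"
    using insert.prems(2)[of H] r by simp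
  then have "linform m (c H) dvd r"
    using prime_elem_dvd_multD[OF prime_linform[of H]] not_linform_dvd_prod[of H B]
      insert.hyps insert.prems(1) by blast
  then show ?case
    using insert.hyps unfolding r by (simp add: mult.commute[of "linform m (c H)"] mult_dvd_mono)
qed simp

lemma Q_neq_0: "Q \<noteq> 0"
  using finite linform_neq_0 by simp

lemma homogeneous_Q: "homogeneous_poly (card A) Q"
proof -
  have "homogeneous_poly (\<Sum>H\<in>A. 1) Q"
    by (intro homogeneous_prod homogeneous_linform)
  then show ?thesis
    by simp
qed

text \<open>Every row paired with the constant vector \<open>c H\<close> is a multiple of the form
  of \<open>H\<close>; \<open>dvd_detf_mult\<close> passes this to the determinant times a nonzero
  scalar \<open>c H j\<close>.\<close>

lemma Q_dvd_detf:
  assumes "\<And>i. i < m \<Longrightarrow> logvec m A c (M i)"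
  shows "Q dvd detf m M"
proof (rule prod_linform_dvd)
  fix H assume H: "H \<in> A"
  obtain j where j: "j < m" "c H j \<noteq> 0"
    using nonzero[OF H] by blast
  have "linform m (c H) dvd (\<Sum>j<m. M i j * const (c H j))" if "i < m" for i
    using assms[OF that] H by (simp add: logvec_def mult.commute)
  then have "linform m (c H) dvd detf m M * const (c H j)"
    using j(1) by (rule dvd_detf_mult)
  then have "linform m (c H) dvd detf m M * const (c H j) * const (inverse (c H j))"
    by (rule dvd_mult2)
  then show "linform m (c H) dvd detf m M"
    using j(2) by (simp add: mult.assoc flip: const_mult)
qed simp

lemma card_le_sum_degrees:
  assumes "\<And>i. i < m \<Longrightarrow> logvec m A c (M i)"
    and "\<And>i j. i < m \<Longrightarrow> j < m \<Longrightarrow> homogeneous_poly (e i) (M i j)" and "detf m M \<noteq> 0"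
  shows "card A \<le> (\<Sum>i<m. e i)"
proof (rule homogeneous_dvd_le[OF homogeneous_Q _ assms(3)])
  show "homogeneous_poly (\<Sum>i<m. e i) (detf m M)"
    by (rule detf_homogeneous) (rule assms(2))
  show "Q dvd detf m M"
    by (rule Q_dvd_detf) (rule assms(1))
qed

text \<open>The degree condition makes the determinant a nonzero scalar multiple of
  \<open>Q\<close>. The numerators in Cramer's rule are determinants of logarithmic rows too, hence
  multiples of \<open>Q\<close>, so the division can be carried out.\<close>

lemma saito_basis:
  assumes M: "\<And>i. i < m \<Longrightarrow> logvec m A c (M i)"
    and hom: "\<And>i j. i < m \<Longrightarrow> j < m \<Longrightarrow> homogeneous_poly (e i) (M i j)"
    and nz: "detf m M \<noteq> 0" and deg: "(\<Sum>i<m. e i) = card A"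
    and v: "logvec m A c v"
  obtains g where "\<And>i. i < m \<Longrightarrow> g i \<in> poly_ring m" "\<And>j. j < m \<Longrightarrow> v j = (\<Sum>i<m. g i * M i j)"
proof -
  have "homogeneous_poly (card A) (detf m M)"
    unfolding deg[symmetric] by (rule detf_homogeneous) (rule hom)
  moreover have "Q dvd detf m M"
    by (rule Q_dvd_detf) (rule M)
  ultimately obtain a where a: "a \<noteq> 0" "detf m M = const a * Q"
    using homogeneous_dvd_imp_const_mult[OF homogeneous_Q _ nz] by blast
  have "\<forall>k. \<exists>h. k < m \<longrightarrow> h \<in> poly_ring m \<and> detf m (M(k := v)) = h * Q"
  proof (intro allI)
    fix k
    have *: "logvec m A c ((M(k := v)) i)" if "i < m" for i
      using M[OF that] v by simp
    have "Q dvd detf m (M(k := v))"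
      by (rule Q_dvd_detf) (rule *)
    moreover have "Q \<in> poly_ring m"
      by (intro poly_ring_prod poly_ring_linform)
    moreover have "detf m (M(k := v)) \<in> poly_ring m"
      by (rule detf_poly_ring) (use * in \<open>auto simp: logvec_def\<close>)
    ultimately obtain q where "q \<in> poly_ring m" "detf m (M(k := v)) = q * Q"
      by (rule poly_ring_dvdE)
    then show "\<exists>h. k < m \<longrightarrow> h \<in> poly_ring m \<and> detf m (M(k := v)) = h * Q"
      by blast
  qed
  then obtain h where "\<forall>k. k < m \<longrightarrow> h k \<in> poly_ring m \<and> detf m (M(k := v)) = h k * Q"
    by (rule choice[THEN exE])
  then have h: "\<And>k. k < m \<Longrightarrow> h k \<in> poly_ring m"
    "\<And>k. k < m \<Longrightarrow> detf m (M(k := v)) = h k * Q"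
    by blast+
  have "v j = (\<Sum>i<m. const (inverse a) * h i * M i j)" if j: "j < m" for j
  proof -
    have "const a * Q * v j = (\<Sum>k<m. h k * Q * M k j)"
      using detf_cramer[OF j, of M v] by (simp add: a(2) h(2))
    also have "\<dots> = const a * Q * (\<Sum>k<m. const (inverse a) * h k * M k j)"
      unfolding sum_distrib_left
    proof (intro sum.cong refl)
      fix k
      have "const a * Q * (const (inverse a) * h k * M k j) = const (a * inverse a) * (h k * Q * M k j)"
        unfolding const_mult by (simp only: mult_ac)
      moreover have "a * inverse a = 1"
        using a(1) by simp
      ultimately show "h k * Q * M k j = const a * Q * (const (inverse a) * h k * M k j)"
        by (simp only: const_1 mult_1)
    qed
    finally show ?thesis
      unfolding mult_cancel_left using a(1) Q_neq_0 by (simp only: mult_eq_0_iff const_eq_0_iff simp_thms)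
  qed
  then show thesis
    using that[of "\<lambda>i. const (inverse a) * h i"] poly_ring_mult[OF poly_ring_const h(1)] by blast
qed

text \<open>These rows have determinant \<open>Q ^ m\<close>, so the determinant of a generating
  family divides a power of \<open>Q\<close>, and in particular is nonzero.\<close>

lemma logvec_mult_unit:
  "logvec m A c (\<lambda>j. if i = j then Q else 0)"
  unfolding logvec_def
proof safe
  fix j show "(if i = j then Q else 0) \<in> poly_ring m"
    by (auto intro: poly_ring_prod)
next
  fix H assume H: "H \<in> A"
  then have "linform m (c H) dvd Q"
    using finite by (simp add: dvd_prod_eqI)
  then show "linform m (c H) dvd (\<Sum>j<m. const (c H j) * (if i = j then Q else 0))"
    by (intro dvd_sum) auto
qed

text \<open>The multiplicity of a linear form in the determinant is one: clearing the other forms, the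
  kernel of the form still contributes derivations of full rank whose determinant has
  this multiplicity.\<close>

lemma saito_degrees:
  assumes M: "\<And>i. i < m \<Longrightarrow> logvec m A c (M i)"
    and hom: "\<And>i j. i < m \<Longrightarrow> j < m \<Longrightarrow> homogeneous_poly (e i) (M i j)"
    and gen: "\<And>v. logvec m A c v \<Longrightarrow> \<exists>g. \<forall>j<m. v j = (\<Sum>i<m. g i * M i j)"
  shows "(\<Sum>i<m. e i) = card A"
proof -
  \<comment> \<open>Generation writes the rows of \<open>N\<close> as a matrix \<open>G\<close>
    times \<open>M\<close>, and determinants are multiplicative.\<close>
  have dvd: "detf m M dvd detf m N" if "\<And>i. i < m \<Longrightarrow> logvec m A c (N i)" for N
  proof -
    have "\<forall>i. \<exists>g. i < m \<longrightarrow> (\<forall>j<m. N i j = (\<Sum>k<m. g k * M k j))"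
      using that gen by blast
    then obtain G where "\<forall>i. i < m \<longrightarrow> (\<forall>j<m. N i j = (\<Sum>k<m. G i k * M k j))"
      by (rule choice[THEN exE])
    then have "detf m N = detf m (\<lambda>i j. \<Sum>k<m. G i k * M k j)"
      by (intro detf_cong) blast
    then show ?thesis
      by (simp add: detf_mult)
  qed
  have dvd_power: "detf m M dvd Q ^ m"
    using dvd[of "\<lambda>i j. if i = j then Q else 0"] logvec_mult_unit by (simp add: detf_diag)
  have "Q dvd detf m M"
    by (rule Q_dvd_detf) (rule M)
  then obtain u where u: "detf m M = Q * u" ..
  have nz: "detf m M \<noteq> 0"
    using dvd_power Q_neq_0 by auto
  have ndvd: "\<not> linform m (c H) dvd u" if H: "H \<in> A" for H
  proof
    assume Hu: "linform m (c H) dvd u"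
    obtain j0 where j0: "j0 < m" "c H j0 \<noteq> 0"
      using nonzero[OF H] by blast
    define R where "R = (\<Prod>H'\<in>A - {H}. linform m (c H'))"
    define r where "r i = c H i / c H j0" for i
    \<comment> \<open>Row \<open>j0\<close> is \<open>Q\<close> times a unit vector. Every other row
      is \<open>R\<close> times the constant vector with entry 1 at \<open>i\<close> and
      \<open>- r i\<close> at \<open>j0\<close>, which the form of \<open>H\<close> annihilates; the
      factor \<open>R\<close> takes care of the other forms.\<close>
    define N where "N i j = (if i = j0 then if j = j0 then Q else 0
       else if j = i then R else if j = j0 then - const (r i) * R else 0)" for i j
    \<comment> \<open>The shear undoing the entries \<open>- r i\<close>: the product of
      \<open>N\<close> and \<open>N'\<close> is diagonal, with \<open>Q\<close> once and
      \<open>R\<close> in the other \<open>m - 1\<close> places.\<close>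
    define N' where "N' k j = (if k = j then 1 else if j = j0 then const (r k) else 0)" for k j
    have Q: "Q = linform m (c H) * R"
      unfolding R_def using H finite by (rule prod.remove[rotated])
    have N: "logvec m A c (N i)" if i: "i < m" for i
    proof (cases "i = j0")
      case True
      then have "N i = (\<lambda>j. if i = j then Q else 0)"
        by (auto simp: N_def)
      then show ?thesis
        using logvec_mult_unit by simp
    next
      case False
      have eq: "(\<Sum>j<m. const (c H' j) * N i j) = const (c H' i - c H' j0 * r i) * R" for H'
      proof -
        have "(\<Sum>j<m. const (c H' j) * N i j) = (\<Sum>j\<in>{i, j0}. const (c H' j) * N i j)"
          by (rule sum.mono_neutral_right) (use i j0 False in \<open>auto simp: N_def\<close>)
        also have "\<dots> = const (c H' i) * R + const (c H' j0) * (- const (r i) * R)"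
          using False by (simp add: N_def)
        also have "\<dots> = const (c H' i + - (c H' j0 * r i)) * R"
          unfolding const_add const_uminus const_mult distrib_right by (simp add: mult.assoc)
        finally show ?thesis
          by simp
      qed
      show ?thesis
        unfolding logvec_def
      proof safe
        fix j show "N i j \<in> poly_ring m"
          unfolding N_def Q R_def
          by (auto intro!: poly_ring_mult poly_ring_prod poly_ring_uminus)
      next
        fix H' assume H': "H' \<in> A"
        show "linform m (c H') dvd (\<Sum>j<m. const (c H' j) * N i j)"
        proof (cases "H' = H")
          case True
          then show ?thesis
            unfolding eq using j0 by (simp add: r_def)
        next
          case False
          then have "linform m (c H') dvd R"
            unfolding R_def using H' finite by (intro dvd_prodI) auto
          then show ?thesis
            unfolding eq by simp
        qed
      qed
    qed
    have "(\<Sum>k<m. N i k * N' k j) = (if i = j then (if i = j0 then Q else R) else 0)"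
      if ij: "i < m" "j < m" for i j
    proof -
      have "(\<Sum>k<m. N i k * N' k j) = (\<Sum>k\<in>{i, j0}. N i k * N' k j)"
        by (rule sum.mono_neutral_right) (use ij j0 in \<open>auto simp: N_def\<close>)
      then show ?thesis
        by (cases "i = j0") (auto simp: N_def N'_def)
    qed
    then have "detf m N * detf m N' = detf m (\<lambda>i j. if i = j then (if i = j0 then Q else R) else 0)"
      unfolding detf_mult[symmetric] by (rule detf_cong)
    also have "\<dots> = Q * R ^ (m - 1)"
      using j0(1) by (simp add: detf_diag prod.remove[of "{..<m}" j0])
    finally have eq: "detf m N * detf m N' = Q * R ^ (m - 1)" .
    have "detf m M dvd detf m N"
      by (rule dvd) (rule N)
    then have "Q * u dvd Q * R ^ (m - 1)"
      unfolding eq[symmetric] u[symmetric] by (rule dvd_mult2)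
    then have "u dvd R ^ (m - 1)"
      using Q_neq_0 by (simp only: dvd_mult_cancel_left simp_thms)
    then have "linform m (c H) dvd R"
      using Hu prime_elem_dvd_power[OF prime_linform[OF H]] dvd_trans by blast
    then show False
      using not_linform_dvd_prod[OF H, of "A - {H}"] by (simp add: R_def)
  qed
  \<comment> \<open>No form divides \<open>u\<close>, so all factors of a power of \<open>Q\<close>
    can be cancelled, leaving a unit.\<close>
  have "u dvd 1" if "u dvd Q ^ k" for k
    using that
  proof (induction k)
    case (Suc k)
    then have "u dvd Q ^ k * Q"
      by (simp add: mult.commute)
    then have "u dvd Q ^ k"
      by (rule dvd_mult_prod_primeD[OF finite, rotated 2]) (use prime_linform ndvd in auto)
    then show ?case
      by (rule Suc.IH)
  qed simp
  then have "u dvd 1"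
    using dvd_power unfolding u by (blast dest: dvd_mult_right)
  then have "detf m M dvd Q"
    unfolding u using mult_dvd_mono[of Q Q u 1] by simp
  moreover have "homogeneous_poly (\<Sum>i<m. e i) (detf m M)"
    by (rule detf_homogeneous) (rule hom)
  ultimately have "(\<Sum>i<m. e i) \<le> card A"
    using homogeneous_dvd_le[OF _ homogeneous_Q Q_neq_0] by blast
  moreover have "card A \<le> (\<Sum>i<m. e i)"
    by (rule card_le_sum_degrees[of M e], erule M, erule (1) hom, rule nz)
  ultimately show ?thesis
    by simp
qed

end

section \<open>Linear functionals and frames\<close>

abbreviation functional :: "('a::field ^ 'n \<Rightarrow> 'a) \<Rightarrow> bool" where
  "functional \<equiv> Vector_Spaces.linear (\<lambda>c (v :: 'a ^ 'n). c *s v) (*)"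

lemma functional_iff:
  "functional \<alpha> \<longleftrightarrow> (\<forall>x y. \<alpha> (x + y) = \<alpha> x + \<alpha> y) \<and> (\<forall>c x. \<alpha> (c *s x) = c * \<alpha> x)"
  using vec.vector_space_axioms vector_space_over_itself.vector_space_axioms
  unfolding Vector_Spaces.linear_iff by blast

lemma
  assumes "functional \<alpha>"
  shows functional_add: "\<alpha> (x + y) = \<alpha> x + \<alpha> y"
    and functional_scale: "\<alpha> (a *s x) = a * \<alpha> x"
    and functional_0: "\<alpha> 0 = 0"
    and functional_diff: "\<alpha> (x - y) = \<alpha> x - \<alpha> y"
    and functional_sum: "\<alpha> (sum h I) = (\<Sum>i\<in>I. \<alpha> (h i))"
proof -
  have add: "\<alpha> (x + y) = \<alpha> x + \<alpha> y" and scale: "\<alpha> (a *s x) = a * \<alpha> x" for x y a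
    using assms unfolding functional_iff by blast+
  show "\<alpha> (x + y) = \<alpha> x + \<alpha> y" and "\<alpha> (a *s x) = a * \<alpha> x"
    by (fact add scale)+
  show zero: "\<alpha> 0 = 0"
    using scale[of 0 0] by simp
  show "\<alpha> (x - y) = \<alpha> x - \<alpha> y"
    using add[of "x - y" y] by simp
  show "\<alpha> (sum h I) = (\<Sum>i\<in>I. \<alpha> (h i))"
    by (induction I rule: infinite_finite_induct) (simp_all add: zero add)
qed

lemma functional_extend:
  assumes "vec.independent B"
  obtains \<alpha> :: "'a::field ^ 'n \<Rightarrow> 'a" where "functional \<alpha>" "\<And>x. x \<in> B \<Longrightarrow> \<alpha> x = h x"
proof -
  interpret vector_space_pair "\<lambda>c (v :: 'a ^ 'n). c *s v" "(*) :: 'a \<Rightarrow> 'a \<Rightarrow> 'a" ..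
  show thesis
    using linear_independent_extend[OF assms, of h] that by blast
qed

lemma frame_mem: "frame W b \<Longrightarrow> j < vec.dim W \<Longrightarrow> b j \<in> W"
  unfolding frame_def by (metis imageI lessThan_iff vec.span_base)

lemma frame_exists:
  assumes "vec.subspace W"
  obtains b where "frame W b"
proof -
  obtain B where B: "B \<subseteq> W" "vec.independent B" "W \<subseteq> vec.span B" "card B = vec.dim W"
    by (rule vec.basis_exists)
  have "finite B"
    using B(2) by (rule vec.finiteI_independent)
  then obtain b where b: "bij_betw b {..<card B} B"
    by (metis ex_bij_betw_nat_finite atLeast0LessThan)
  have "vec.span B = W"
    using B(1,3) vec.span_minimal[OF B(1) assms] by blast
  then have "frame W b"
    using b B unfolding frame_def bij_betw_def by simp
  then show thesis
    by (rule that)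
qed

text \<open>Coordinates on \<open>W\<close> are represented by functionals on the whole space, as
  defining forms are; only their values on \<open>W\<close> are determined by the frame.\<close>

lemma dual_frame:
  fixes b :: "nat \<Rightarrow> 'a::field ^ 'n"
  assumes b: "frame W b"
  obtains \<gamma> :: "nat \<Rightarrow> 'a ^ 'n \<Rightarrow> 'a" where "\<And>j. functional (\<gamma> j)"
    and "\<And>j l. j < vec.dim W \<Longrightarrow> l < vec.dim W \<Longrightarrow> \<gamma> j (b l) = (if j = l then 1 else 0)"
proof -
  have "\<exists>\<gamma>. functional \<gamma> \<and> (\<forall>l<vec.dim W. j < vec.dim W \<longrightarrow> \<gamma> (b l) = (if j = l then 1 else 0))" for j
  proof -
    obtain \<gamma> :: "'a ^ 'n \<Rightarrow> 'a" where \<gamma>: "functional \<gamma>"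
      "\<And>x. x \<in> b ` {..<vec.dim W} \<Longrightarrow> \<gamma> x = (if x = b j then 1 else 0)"
      using b unfolding frame_def
      by (metis functional_extend[of "b ` {..<vec.dim W}" "\<lambda>x. if x = b j then 1 else 0"])
    have "\<gamma> (b l) = (if j = l then 1 else 0)" if "l < vec.dim W" "j < vec.dim W" for l
    proof -
      have "b l = b j \<longleftrightarrow> j = l"
        using b that unfolding frame_def inj_on_def by blast
      then show ?thesis
        using \<gamma>(2)[of "b l"] that(1) by simp
    qed
    then show ?thesis
      using \<gamma>(1) by blast
  qed
  then obtain \<gamma> where "\<forall>j. functional (\<gamma> j) \<and> (\<forall>l<vec.dim W. j < vec.dim W \<longrightarrow> \<gamma> j (b l) = (if j = l then 1 else 0))"
    using choice[of "\<lambda>j \<gamma>. functional \<gamma> \<and> (\<forall>l<vec.dim W. j < vec.dim W \<longrightarrow> \<gamma> (b l) = (if j = l then 1 else 0))"]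
    by blast
  then show thesis
    using that[of \<gamma>] by blast
qed

lemma frame_expand:
  assumes b: "frame W b" and \<gamma>: "\<And>j. functional (\<gamma> j)"
    "\<And>j l. j < vec.dim W \<Longrightarrow> l < vec.dim W \<Longrightarrow> \<gamma> j (b l) = (if j = l then 1 else 0)"
    and w: "w \<in> W"
  shows "w = (\<Sum>j<vec.dim W. \<gamma> j w *s b j)"
proof -
  define F where "F w = (\<Sum>j<vec.dim W. \<gamma> j w *s b j)" for w
  have F: "F 0 = 0" "F (x + y) = F x + F y" "F (a *s x) = a *s F x" for x y a
    by (simp_all add: F_def functional_0[OF \<gamma>(1)] functional_add[OF \<gamma>(1)] functional_scale[OF \<gamma>(1)]
        vec.scale_left_distrib sum.distrib vec.scale_sum_right)
  have sub: "vec.subspace {w. F w = w}"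
    unfolding vec.subspace_def by (simp add: F)
  have base: "b ` {..<vec.dim W} \<subseteq> {w. F w = w}"
  proof safe
    fix l assume l: "l < vec.dim W"
    have "F (b l) = (\<Sum>j<vec.dim W. if j = l then b l else 0)"
      unfolding F_def by (rule sum.cong) (use l in \<open>auto simp: \<gamma>(2)\<close>)
    then show "F (b l) = b l"
      using l by simp
  qed
  have "W \<subseteq> {w. F w = w}"
    using vec.span_minimal[OF base sub] b by (simp add: frame_def)
  then show ?thesis
    using w unfolding F_def by auto
qed

lemma functional_eq_on_frame:
  assumes b: "frame W b" and \<gamma>: "\<And>j. functional (\<gamma> j)"
    "\<And>j l. j < vec.dim W \<Longrightarrow> l < vec.dim W \<Longrightarrow> \<gamma> j (b l) = (if j = l then 1 else 0)"
    and \<alpha>: "functional \<alpha>" and w: "w \<in> W"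
  shows "\<alpha> w = (\<Sum>j<vec.dim W. \<alpha> (b j) * \<gamma> j w)"
  by (subst frame_expand[OF b \<gamma> w])
     (simp_all add: functional_sum[OF \<alpha>] functional_scale[OF \<alpha>] mult.commute)

lemma functional_0_on_frame:
  assumes b: "frame W b" and \<alpha>: "functional \<alpha>" and 0: "\<And>j. j < vec.dim W \<Longrightarrow> \<alpha> (b j) = 0" and w: "w \<in> W"
  shows "\<alpha> w = 0"
proof -
  obtain \<gamma> :: "nat \<Rightarrow> 'a ^ 'b \<Rightarrow> 'a" where "\<And>j. functional (\<gamma> j)"
    "\<And>j l. j < vec.dim W \<Longrightarrow> l < vec.dim W \<Longrightarrow> \<gamma> j (b l) = (if j = l then 1 else 0)"
    by (rule dual_frame[OF b]) blast
  from functional_eq_on_frame[OF b this \<alpha> w] show ?thesis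
    by (simp add: 0)
qed

lemma functional_linear_combination:
  assumes "functional \<alpha>" "functional \<beta>"
  shows "functional (\<lambda>x. p * \<alpha> x + q * \<beta> x)"
  using assms unfolding functional_iff by (simp add: algebra_simps)

lemma functional_sum_mult:
  assumes "\<And>j. j \<in> J \<Longrightarrow> functional (\<gamma> j)"
  shows "functional (\<lambda>x. \<Sum>j\<in>J. a j * \<gamma> j x)"
  unfolding functional_iff
  by (auto simp: functional_add[OF assms] functional_scale[OF assms] distrib_left sum.distrib
      sum_distrib_left mult.left_commute)

text \<open>For \<open>x\<close> in \<open>W\<close> outside \<open>H\<close>, subtracting the right
  multiple of \<open>x\<close> moves any \<open>w\<close> into the common kernel, so the ratio of
  the values at \<open>x\<close> is the factor everywhere.\<close>

lemma defining_form_proportional: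
  assumes \<alpha>: "defining_form W H \<alpha>" and \<beta>: "defining_form W H \<beta>" and W: "vec.subspace W" "H \<noteq> W"
  obtains c where "c \<noteq> 0" "\<And>w. w \<in> W \<Longrightarrow> \<beta> w = c * \<alpha> w"
proof -
  have lin: "functional \<alpha>" "functional \<beta>" and ker: "{w \<in> W. \<alpha> w = 0} = H" "{w \<in> W. \<beta> w = 0} = H"
    using \<alpha> \<beta> by (auto simp: defining_form_def)
  obtain x where x: "x \<in> W" "\<alpha> x \<noteq> 0"
    using ker(1) W(2) by blast
  then have bx: "\<beta> x \<noteq> 0"
    using ker by blast
  have "\<beta> w = \<beta> x / \<alpha> x * \<alpha> w" if w: "w \<in> W" for w
  proof -
    let ?y = "w - (\<alpha> w / \<alpha> x) *s x"
    have "?y \<in> W"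
      using w x(1) W(1) by (simp add: vec.subspace_diff vec.subspace_scale)
    moreover have "\<alpha> ?y = 0"
      using x(2) by (simp add: functional_diff[OF lin(1)] functional_scale[OF lin(1)])
    ultimately have "\<beta> ?y = 0"
      using ker by blast
    then show ?thesis
      by (simp add: functional_diff[OF lin(2)] functional_scale[OF lin(2)])
  qed
  then show thesis
    using that[of "\<beta> x / \<alpha> x"] bx x(2) by simp
qed

text \<open>Adjoining one vector \<open>v\<close> outside \<open>H\<close> to a basis of
  \<open>H\<close> gives a basis of the space; the coordinate along \<open>v\<close> is the
  form.\<close>

lemma hyperplane_defining_form:
  fixes H :: "('a::field ^ 'n) set"
  assumes H: "vec.subspace H" "vec.dim H + 1 = CARD('n)"
  obtains \<alpha> where "defining_form UNIV H \<alpha>"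
proof -
  obtain B where B: "B \<subseteq> H" "vec.independent B" "H \<subseteq> vec.span B" "card B = vec.dim H"
    by (rule vec.basis_exists)
  have span_B: "vec.span B = H"
    using B(1,3) vec.span_minimal[OF B(1) H(1)] by blast
  have "H \<noteq> UNIV"
    using H(2) vec_dim_card[where 'a = 'a and 'n = 'n] by (metis Suc_eq_plus1 n_not_Suc_n)
  then obtain v where v: "v \<notin> H"
    by blast
  then have ind: "vec.independent (insert v B)"
    using B(2) span_B by (simp add: vec.independent_insertI)
  have "card (insert v B) = CARD('n)"
    using v B H(2) vec.finiteI_independent[OF B(2)] by (auto simp: card_insert_if)
  then have full: "vec.span (insert v B) = UNIV"
    using vec.card_ge_dim_independent[OF subset_UNIV ind] unfolding vec_dim_card by auto
  obtain \<alpha> :: "'a ^ 'n \<Rightarrow> 'a" where \<alpha>: "functional \<alpha>" "\<And>x. x \<in> insert v B \<Longrightarrow> \<alpha> x = (if x = v then 1 else 0)"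
    by (rule functional_extend[OF ind, where h = "\<lambda>x. if x = v then 1 else 0"]) blast
  have zero: "\<alpha> x = 0" if "x \<in> H" for x
  proof -
    have "vec.subspace {x. \<alpha> x = 0}"
      unfolding vec.subspace_def
      by (auto simp: functional_0[OF \<alpha>(1)] functional_add[OF \<alpha>(1)] functional_scale[OF \<alpha>(1)])
    moreover have "B \<subseteq> {x. \<alpha> x = 0}"
      using \<alpha>(2) v B(1) by auto
    ultimately show ?thesis
      using vec.span_minimal[of B "{x. \<alpha> x = 0}"] span_B that by blast
  qed
  have "x \<in> H" if x: "\<alpha> x = 0" for x
  proof -
    obtain k where k: "x - k *s v \<in> H"
      using full span_B vec.span_breakdown_eq[of x v B] by auto
    then have "\<alpha> (x - k *s v) = 0"
      by (rule zero)
    then have "k = 0"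
      using x \<alpha>(2)[of v] by (simp add: functional_diff[OF \<alpha>(1)] functional_scale[OF \<alpha>(1)])
    then show ?thesis
      using k by simp
  qed
  then have "defining_form UNIV H \<alpha>"
    using \<alpha>(1) zero unfolding defining_form_def by blast
  then show thesis
    by (rule that)
qed

section \<open>Free arrangements in terms of coefficient families\<close>

definition deriv_op :: "nat \<Rightarrow> (nat \<Rightarrow> 'a::field mpoly) \<Rightarrow> 'a mpoly \<Rightarrow> 'a mpoly" where
  "deriv_op m f = (\<lambda>p. \<Sum>i<m. f i * partial i p)"

lemma deriv_op_linform: "deriv_op m f (linform m a) = (\<Sum>i<m. const (a i) * f i)"
  unfolding deriv_op_def partial_linform by (intro sum.cong refl) (simp add: mult.commute)

lemma deriv_op_var: "i < m \<Longrightarrow> deriv_op m f (var i) = f i"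
  using deriv_op_linform[of m f "\<lambda>j. if j = i then 1 else 0"]
  by (simp add: if_distrib[of const] if_distrib[of "\<lambda>x. x * _"] cong: if_cong)

lemma deriv_op_combination:
  "(\<lambda>p. \<Sum>j<n. g j * deriv_op m (M j) p) = deriv_op m (\<lambda>i. \<Sum>j<n. g j * M j i)"
  unfolding deriv_op_def sum_distrib_left sum_distrib_right
  by (subst sum.swap) (simp add: mult.assoc)

lemma deriv_op_eqD: "deriv_op m f = deriv_op m g \<Longrightarrow> i < m \<Longrightarrow> f i = g i"
  by (metis deriv_op_var)

lemma deriv_op_cong: "(\<And>i. i < m \<Longrightarrow> f i = g i) \<Longrightarrow> deriv_op m f = deriv_op m g"
  unfolding deriv_op_def by (intro ext sum.cong) auto

lemma deriv_op_0: "deriv_op m (\<lambda>i. 0) = (\<lambda>p. 0)"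
  by (simp add: deriv_op_def)

lemma derivations_iff: "\<theta> \<in> derivations m \<longleftrightarrow> (\<exists>f. (\<forall>i<m. f i \<in> poly_ring m) \<and> \<theta> = deriv_op m f)"
  by (simp add: derivations_def deriv_op_def)

lemma homogeneous_deriv_op_iff:
  "homogeneous_derivation m d (deriv_op m f) \<longleftrightarrow> (\<forall>i<m. homogeneous_poly d (f i))"
proof safe
  fix i assume hom: "homogeneous_derivation m d (deriv_op m f)" and i: "i < m"
  have "linform m (\<lambda>j. if j = i then 1 else 0) = (var i :: 'a mpoly)"
    using i by (simp add: if_distrib[of const] if_distrib[of "\<lambda>x. x * _"] cong: if_cong)
  then show "homogeneous_poly d (f i)"
    using hom i deriv_op_var[of i m f] unfolding homogeneous_derivation_def by metis
next
  assume "\<forall>i<m. homogeneous_poly d (f i)"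
  then show "homogeneous_derivation m d (deriv_op m f)"
    unfolding homogeneous_derivation_def deriv_op_linform
    by (auto intro!: homogeneous_sum homogeneous_const_mult)
qed

lemma form_poly_dvd_imp_mult:
  assumes "form_poly W b \<alpha> dvd p" "p \<in> poly_ring (vec.dim W)"
  obtains q where "q \<in> poly_ring (vec.dim W)" "p = q * form_poly W b \<alpha>"
  by (rule poly_ring_dvdE[OF assms(1) _ assms(2)]) (auto simp: form_poly_def)

text \<open>One form is fixed for each hyperplane. Properness together with a defining form encodes
  codimension one, so the restriction fits without computing the dimension of
  \<open>X \<inter> H\<close>.\<close>

locale formed_arrangement =
  fixes W :: "('a::field ^ 'n) set" and A :: "('a ^ 'n) set set" and \<alpha> :: "('a ^ 'n) set \<Rightarrow> 'a ^ 'n \<Rightarrow> 'a"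
  assumes subspace: "vec.subspace W" and finite: "finite A"
    and form: "H \<in> A \<Longrightarrow> defining_form W H (\<alpha> H)" and proper: "H \<in> A \<Longrightarrow> H \<noteq> W"
begin

abbreviation coeffs :: "(nat \<Rightarrow> 'a ^ 'n) \<Rightarrow> ('a ^ 'n) set \<Rightarrow> nat \<Rightarrow> 'a" where
  "coeffs b \<equiv> \<lambda>H i. \<alpha> H (b i)"

lemma functional_form: "H \<in> A \<Longrightarrow> functional (\<alpha> H)"
  and kernel_form: "H \<in> A \<Longrightarrow> {w \<in> W. \<alpha> H w = 0} = H"
  using form by (auto simp: defining_form_def)

lemma linear_forms:
  assumes b: "frame W b"
  shows "linear_forms (vec.dim W) A (coeffs b)"
proof
  show "finite A"
    by (rule finite)
  show nz: "\<exists>j<vec.dim W. \<alpha> H (b j) \<noteq> 0" if H: "H \<in> A" for H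
  proof (rule ccontr)
    assume "\<not> ?thesis"
    then have "\<alpha> H w = 0" if "w \<in> W" for w
      using functional_0_on_frame[OF b functional_form[OF H]] that by blast
    then show False
      using kernel_form[OF H] proper[OF H] by blast
  qed
  show "H = H'" if H: "H \<in> A" "H' \<in> A"
    and dvd: "linform (vec.dim W) (coeffs b H) dvd linform (vec.dim W) (coeffs b H')" for H H'
  proof -
    obtain c where c: "c \<noteq> 0" "\<And>i. i < vec.dim W \<Longrightarrow> \<alpha> H' (b i) = c * \<alpha> H (b i)"
      using linform_dvd_linformD[OF dvd nz[OF H(2)]] by blast
    have fun_diff: "functional (\<lambda>x. 1 * \<alpha> H' x + (- c) * \<alpha> H x)"
      by (intro functional_linear_combination functional_form H)
    have "1 * \<alpha> H' w + (- c) * \<alpha> H w = 0" if w: "w \<in> W" for w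
      by (rule functional_0_on_frame[OF b fun_diff _ w]) (simp add: c(2))
    then have "\<alpha> H' w = c * \<alpha> H w" if "w \<in> W" for w
      using that by fastforce
    then have "{w \<in> W. \<alpha> H w = 0} = {w \<in> W. \<alpha> H' w = 0}"
      using c(1) by auto
    then show ?thesis
      using kernel_form H by simp
  qed
qed

text \<open>Any defining form is a nonzero scalar multiple of the chosen one on \<open>W\<close>, so
  the chosen forms decide membership.\<close>

lemma log_derivations_iff:
  assumes b: "frame W b"
  shows "\<theta> \<in> log_derivations W b A \<longleftrightarrow> (\<exists>f. \<theta> = deriv_op (vec.dim W) f \<and> logvec (vec.dim W) A (coeffs b) f)"
    (is "?L \<longleftrightarrow> ?R")
proof
  assume L: ?L
  then obtain f where f: "\<forall>i<vec.dim W. f i \<in> poly_ring (vec.dim W)" "\<theta> = deriv_op (vec.dim W) f"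
    unfolding log_derivations_def by (auto simp: derivations_iff)
  have "linform (vec.dim W) (coeffs b H) dvd (\<Sum>j<vec.dim W. const (coeffs b H j) * f j)" if H: "H \<in> A" for H
  proof -
    obtain q where "\<theta> (form_poly W b (\<alpha> H)) = q * form_poly W b (\<alpha> H)"
      using L H form[OF H] unfolding log_derivations_def by blast
    then show ?thesis
      unfolding f(2) form_poly_def deriv_op_linform by (rule dvdI[OF trans[OF _ mult.commute]])
  qed
  then show ?R
    using f unfolding logvec_def by blast
next
  assume ?R
  then obtain f where \<theta>: "\<theta> = deriv_op (vec.dim W) f" and f: "\<And>i. i < vec.dim W \<Longrightarrow> f i \<in> poly_ring (vec.dim W)"
    and dvd: "\<And>H. H \<in> A \<Longrightarrow> linform (vec.dim W) (coeffs b H) dvd (\<Sum>j<vec.dim W. const (coeffs b H j) * f j)"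
    unfolding logvec_def by blast
  have "\<exists>q\<in>poly_ring (vec.dim W). \<theta> (form_poly W b \<beta>) = q * form_poly W b \<beta>"
    if H: "H \<in> A" and \<beta>: "defining_form W H \<beta>" for H \<beta>
  proof -
    obtain c where c: "c \<noteq> 0" "\<And>w. w \<in> W \<Longrightarrow> \<beta> w = c * \<alpha> H w"
      using defining_form_proportional[OF form[OF H] \<beta> subspace proper[OF H]] by blast
    have eq: "(\<Sum>j<vec.dim W. const (\<beta> (b j)) * h j) = const c * (\<Sum>j<vec.dim W. const (coeffs b H j) * h j)" for h
      unfolding sum_distrib_left
      by (intro sum.cong refl) (simp add: c(2) frame_mem[OF b] const_mult mult.assoc)
    have "form_poly W b \<beta> dvd \<theta> (form_poly W b \<beta>)"
      unfolding form_poly_def \<theta> deriv_op_linform unfolding eq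
      by (rule mult_dvd_mono[OF dvd_refl dvd[OF H]])
    moreover have "\<theta> (form_poly W b \<beta>) \<in> poly_ring (vec.dim W)"
      unfolding form_poly_def \<theta> deriv_op_linform
      by (intro poly_ring_sum poly_ring_mult poly_ring_const f) simp
    ultimately obtain q where "q \<in> poly_ring (vec.dim W)" "\<theta> (form_poly W b \<beta>) = q * form_poly W b \<beta>"
      by (rule form_poly_dvd_imp_mult)
    then show ?thesis
      by blast
  qed
  moreover have "\<theta> \<in> derivations (vec.dim W)"
    unfolding derivations_iff using \<theta> f by blast
  ultimately show ?L
    unfolding log_derivations_def by blast
qed

lemma free_with_exponentsE:
  assumes "free_with_exponents W A E"
  obtains b M e where "frame W b" "\<And>j. j < vec.dim W \<Longrightarrow> logvec (vec.dim W) A (coeffs b) (M j)"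
    "\<And>j i. j < vec.dim W \<Longrightarrow> i < vec.dim W \<Longrightarrow> homogeneous_poly (e j) (M j i)"
    "\<And>v. logvec (vec.dim W) A (coeffs b) v \<Longrightarrow> \<exists>g. \<forall>i<vec.dim W. v i = (\<Sum>j<vec.dim W. g j * M j i)"
    "E = image_mset e (mset_set {..<vec.dim W})"
proof -
  let ?m = "vec.dim W"
  obtain b \<theta> e where b: "frame W b" and basis: "module_basis ?m (log_derivations W b A) ?m \<theta>"
    and hom: "\<And>j. j < ?m \<Longrightarrow> homogeneous_derivation ?m (e j) (\<theta> j)"
    and E: "E = image_mset e (mset_set {..<?m})"
    using assms unfolding free_with_exponents_def by blast
  have "\<forall>j. \<exists>f. j < ?m \<longrightarrow> \<theta> j = deriv_op ?m f \<and> logvec ?m A (coeffs b) f"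
    using basis unfolding module_basis_def log_derivations_iff[OF b] by blast
  then obtain M where M: "\<forall>j. j < ?m \<longrightarrow> \<theta> j = deriv_op ?m (M j) \<and> logvec ?m A (coeffs b) (M j)"
    by (rule choice[THEN exE])
  have "\<exists>g. \<forall>i<?m. v i = (\<Sum>j<?m. g j * M j i)" if v: "logvec ?m A (coeffs b) v" for v
  proof -
    have "deriv_op ?m v \<in> log_derivations W b A"
      using v log_derivations_iff[OF b] by blast
    then obtain g where "deriv_op ?m v = (\<lambda>p. \<Sum>j<?m. g j * \<theta> j p)"
      using basis unfolding module_basis_def by blast
    also have "\<dots> = (\<lambda>p. \<Sum>j<?m. g j * deriv_op ?m (M j) p)"
      using M by simp
    also have "\<dots> = deriv_op ?m (\<lambda>i. \<Sum>j<?m. g j * M j i)"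
      by (rule deriv_op_combination)
    finally show ?thesis
      using deriv_op_eqD by blast
  qed
  moreover have "homogeneous_poly (e j) (M j i)" if "j < ?m" "i < ?m" for j i
    using hom[OF that(1)] M that homogeneous_deriv_op_iff by metis
  ultimately show thesis
    using that[of b M e] b M E by blast
qed

text \<open>The determinant yields both halves of a basis: its nonvanishing gives independence, its
  degree gives generation.\<close>

lemma free_with_exponentsI:
  assumes b: "frame W b" and M: "\<And>j. j < vec.dim W \<Longrightarrow> logvec (vec.dim W) A (coeffs b) (M j)"
    and hom: "\<And>j i. j < vec.dim W \<Longrightarrow> i < vec.dim W \<Longrightarrow> homogeneous_poly (e j) (M j i)"
    and nz: "detf (vec.dim W) M \<noteq> 0" and deg: "(\<Sum>j<vec.dim W. e j) = card A"
  shows "free_with_exponents W A (image_mset e (mset_set {..<vec.dim W}))"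
proof -
  let ?m = "vec.dim W"
  interpret linear_forms ?m A "coeffs b"
    by (rule linear_forms[OF b])
  have "module_basis ?m (log_derivations W b A) ?m (\<lambda>j. deriv_op ?m (M j))"
    unfolding module_basis_def
  proof (intro conjI allI impI ballI)
    fix j assume "j < ?m"
    then show "deriv_op ?m (M j) \<in> log_derivations W b A"
      using M log_derivations_iff[OF b] by blast
  next
    fix \<eta> assume "\<eta> \<in> log_derivations W b A"
    then obtain v where \<eta>: "\<eta> = deriv_op ?m v" and v: "logvec ?m A (coeffs b) v"
      using log_derivations_iff[OF b] by blast
    obtain g where g: "\<And>i. i < ?m \<Longrightarrow> g i \<in> poly_ring ?m"
      "\<And>j. j < ?m \<Longrightarrow> v j = (\<Sum>i<?m. g i * M i j)"
      by (rule saito_basis[of M e v]) (use M hom nz deg v in blast)+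
    have "\<eta> = (\<lambda>p. \<Sum>j<?m. g j * deriv_op ?m (M j) p)"
      unfolding \<eta> deriv_op_combination by (rule deriv_op_cong) (rule g(2))
    then show "\<exists>g. (\<forall>j<?m. g j \<in> poly_ring ?m) \<and> \<eta> = (\<lambda>p. \<Sum>j<?m. g j * deriv_op ?m (M j) p)"
      using g(1) by blast
  next
    fix g j
    assume g: "(\<forall>j<?m. g j \<in> poly_ring ?m) \<and> (\<lambda>p. \<Sum>j<?m. g j * deriv_op ?m (M j) p) = (\<lambda>p. 0)" and j: "j < ?m"
    then have "deriv_op ?m (\<lambda>i. \<Sum>j<?m. g j * M j i) = deriv_op ?m (\<lambda>i. 0)"
      unfolding deriv_op_combination deriv_op_0 by blast
    then have "(\<Sum>j<?m. g j * M j i) = 0" if "i < ?m" for i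
      using deriv_op_eqD[of ?m "\<lambda>i. \<Sum>j<?m. g j * M j i" "\<lambda>i. 0" i] that by blast
    then show "g j = 0"
      using detf_neq_0_independent[OF nz, of g j] j by blast
  qed
  moreover have "\<forall>j<?m. homogeneous_derivation ?m (e j) (deriv_op ?m (M j))"
    using hom homogeneous_deriv_op_iff by blast
  ultimately show ?thesis
    unfolding free_with_exponents_def using b by blast
qed

lemma free_with_exponents_card:
  assumes "free_with_exponents W A E"
  shows "size E = vec.dim W" "sum_mset E = card A"
proof -
  obtain b M e where b: "frame W b" and M: "\<And>j. j < vec.dim W \<Longrightarrow> logvec (vec.dim W) A (coeffs b) (M j)"
    and hom: "\<And>j i. j < vec.dim W \<Longrightarrow> i < vec.dim W \<Longrightarrow> homogeneous_poly (e j) (M j i)"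
    and gen: "\<And>v. logvec (vec.dim W) A (coeffs b) v \<Longrightarrow> \<exists>g. \<forall>i<vec.dim W. v i = (\<Sum>j<vec.dim W. g j * M j i)"
    and E: "E = image_mset e (mset_set {..<vec.dim W})"
    by (rule free_with_exponentsE[OF assms]) blast
  interpret linear_forms "vec.dim W" A "coeffs b"
    by (rule linear_forms[OF b])
  have "(\<Sum>j<vec.dim W. e j) = card A"
    by (rule saito_degrees[of M e]) (use M hom gen in blast)+
  then show "size E = vec.dim W" "sum_mset E = card A"
    by (simp_all add: E sum_unfold_sum_mset)
qed

end

section \<open>Selecting a maximal minor\<close>

text \<open>Over the fraction field, \<open>full\<close> says that the rows span the whole space.
  The nonzero row \<open>j0\<close> extends to a basis consisting of rows, which keeps the
  prescribed index in the selection.\<close>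

lemma exists_nonzero_minor:
  fixes w :: "nat \<Rightarrow> nat \<Rightarrow> 'r::idom"
  assumes full: "\<And>l. l < m \<Longrightarrow> \<exists>c g. c \<noteq> 0 \<and> (\<forall>l'<m. (\<Sum>j<n. g j * w j l') = (if l = l' then c else 0))"
    and j0: "j0 < n" "l0 < m" "w j0 l0 \<noteq> 0"
  obtains s where "inj_on s {..<m}" "s ` {..<m} \<subseteq> {..<n}" "j0 \<in> s ` {..<m}" "detf m (\<lambda>i. w (s i)) \<noteq> 0"
proof -
  interpret F: vector_space "\<lambda>(c :: 'r fract) (f :: nat \<Rightarrow> 'r fract) i. c * f i"
    by unfold_locales (auto simp: fun_eq_iff algebra_simps)
  \<comment> \<open>Entries from \<open>m\<close> on are set to zero, so that all rows lie in the
    span of the first \<open>m\<close> unit vectors.\<close>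
  define v where "v j = (\<lambda>l. if l < m then to_fract (w j l) else 0)" for j
  define E where "E l = (\<lambda>l'. if l = l' then 1 else 0 :: 'r fract)" for l :: nat
  have sum_fun: "sum f I l = (\<Sum>i\<in>I. f i l)" for f :: "'i \<Rightarrow> nat \<Rightarrow> 'r fract" and I l
    by (induction I rule: infinite_finite_induct) auto
  have v_E: "v j \<in> F.span (E ` {..<m})" for j
  proof -
    have "v j = (\<Sum>l<m. (\<lambda>i. v j l * E l i))"
      by (auto simp: fun_eq_iff sum_fun E_def v_def if_distrib cong: if_cong)
    also have "\<dots> \<in> F.span (E ` {..<m})"
      by (intro F.span_sum F.span_scale F.span_base) auto
    finally show ?thesis .
  qed
  have E_v: "E l \<in> F.span (v ` {..<n})" if l: "l < m" for l
  proof -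
    obtain c g where c: "c \<noteq> 0" "\<And>l'. l' < m \<Longrightarrow> (\<Sum>j<n. g j * w j l') = (if l = l' then c else 0)"
      using full[OF l] by blast
    have "E l = (\<Sum>j<n. (\<lambda>i. (to_fract (g j) / to_fract c) * v j i))"
    proof
      fix i
      show "E l i = (\<Sum>j<n. (\<lambda>i. (to_fract (g j) / to_fract c) * v j i)) i"
      proof (cases "i < m")
        case True
        then have "(\<Sum>j<n. (to_fract (g j) / to_fract c) * v j i) = to_fract (\<Sum>j<n. g j * w j i) / to_fract c"
          by (simp add: v_def to_fract_sum sum_divide_distrib)
        then show ?thesis
          using c True by (simp add: sum_fun E_def)
      next
        case False
        then show ?thesis
          using l by (simp add: sum_fun E_def v_def)
      qed
    qed
    also have "\<dots> \<in> F.span (v ` {..<n})"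
      by (intro F.span_sum F.span_scale F.span_base) auto
    finally show ?thesis .
  qed
  have inj_E: "inj_on E {..<m}"
    by (rule inj_onI) (metis E_def zero_neq_one)
  have ind_E: "F.independent (E ` {..<m})"
  proof (rule F.independent_if_scalars_zero)
    fix f x assume 0: "(\<Sum>x\<in>E ` {..<m}. (\<lambda>i. f x * x i)) = 0" and "x \<in> E ` {..<m}"
    then obtain l where l: "l < m" "x = E l"
      by blast
    have "0 = (\<Sum>x\<in>E ` {..<m}. (\<lambda>i. f x * x i)) l"
      using 0 by simp
    also have "\<dots> = (\<Sum>k<m. f (E k) * E k l)"
      by (simp add: sum_fun sum.reindex[OF inj_E])
    also have "\<dots> = f x"
      using l by (simp add: E_def if_distrib cong: if_cong)
    finally show "f x = 0" ..
  qed simp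
  have "v j0 \<noteq> 0"
    using j0 by (auto simp: v_def fun_eq_iff)
  then have ind_v: "F.independent {v j0}"
    by simp
  have "{v j0} \<subseteq> v ` {..<n}"
    using j0 by blast
  then obtain B where B: "{v j0} \<subseteq> B" "B \<subseteq> v ` {..<n}" "F.independent B" "v ` {..<n} \<subseteq> F.span B"
    using ind_v by (rule F.maximal_independent_subset_extend)
  have fin_B: "finite B"
    using B(2) by (rule finite_subset) simp
  have "B \<subseteq> F.span (E ` {..<m})"
    using B(2) v_E by blast
  then have "card B \<le> card (E ` {..<m})"
    using F.independent_span_bound[OF _ B(3)] by blast
  moreover have "E ` {..<m} \<subseteq> F.span B"
    using E_v F.span_minimal[OF B(4) F.subspace_span] by blast
  then have "card (E ` {..<m}) \<le> card B"
    using F.independent_span_bound[OF fin_B ind_E] by blast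
  ultimately have "card B = m"
    by (simp add: card_image[OF inj_E])
  then obtain h where h: "bij_betw h {..<m} B"
    using ex_bij_betw_nat_finite[OF fin_B] by (auto simp: atLeast0LessThan)
  \<comment> \<open>Different indices may carry the same row, so the vector \<open>v j0\<close> is
    explicitly assigned the index \<open>j0\<close>.\<close>
  have "\<forall>i. \<exists>j. i < m \<longrightarrow> j < n \<and> v j = h i \<and> (h i = v j0 \<longrightarrow> j = j0)"
  proof
    fix i
    show "\<exists>j. i < m \<longrightarrow> j < n \<and> v j = h i \<and> (h i = v j0 \<longrightarrow> j = j0)"
    proof (cases "i < m \<and> h i \<noteq> v j0")
      case True
      then have "h i \<in> v ` {..<n}"
        using h B(2) unfolding bij_betw_def by blast
      then show ?thesis
        using True by force
    next
      case False
      then show ?thesis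
        using j0(1) by force
    qed
  qed
  then obtain s where "\<forall>i. i < m \<longrightarrow> s i < n \<and> v (s i) = h i \<and> (h i = v j0 \<longrightarrow> s i = j0)"
    by (rule choice[THEN exE])
  then have s: "\<And>i. i < m \<Longrightarrow> s i < n" "\<And>i. i < m \<Longrightarrow> v (s i) = h i"
    "\<And>i. i < m \<Longrightarrow> h i = v j0 \<Longrightarrow> s i = j0"
    by blast+
  have "inj_on s {..<m}"
  proof (rule inj_onI)
    fix i i' assume ii': "i \<in> {..<m}" "i' \<in> {..<m}" "s i = s i'"
    then have "h i = h i'"
      using s(2)[of i] s(2)[of i'] by simp
    then show "i = i'"
      using h ii' unfolding bij_betw_def inj_on_def by blast
  qed
  moreover have "j0 \<in> s ` {..<m}"
  proof -
    have "v j0 \<in> h ` {..<m}"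
      using h B(1) unfolding bij_betw_def by blast
    then show ?thesis
      using s(3) by force
  qed
  moreover have "detf m (\<lambda>i. w (s i)) \<noteq> 0"
  proof
    assume "detf m (\<lambda>i. w (s i)) = 0"
    then obtain u i where u: "i < m" "u i \<noteq> 0" "\<And>l. l < m \<Longrightarrow> (\<Sum>i<m. u i * w (s i) l) = 0"
      by (rule detf_eq_0D) blast
    \<comment> \<open>A relation among the selected rows, rewritten with scalars attached to the
      vectors of \<open>B\<close> to contradict their independence.\<close>
    define u' where "u' x = to_fract (u (the_inv_into {..<m} h x))" for x
    have u': "u' (h i) = to_fract (u i)" if "i < m" for i
      using h that unfolding u'_def bij_betw_def by (simp add: the_inv_into_f_f)
    have "(\<Sum>x\<in>B. (\<lambda>l. u' x * x l)) = (\<Sum>i<m. (\<lambda>l. u' (h i) * h i l))"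
      by (rule sum.reindex_bij_betw[OF h, symmetric])
    also have "\<dots> = 0"
    proof
      fix l
      have "(\<Sum>i<m. u' (h i) * h i l) = (\<Sum>i<m. to_fract (u i) * v (s i) l)"
        by (intro sum.cong refl) (simp add: u' s(2))
      also have "\<dots> = (if l < m then to_fract (\<Sum>i<m. u i * w (s i) l) else 0)"
        by (simp add: v_def to_fract_sum)
      also have "\<dots> = 0"
        by (simp add: u(3))
      finally show "(\<Sum>i<m. (\<lambda>l. u' (h i) * h i l)) l = 0 l"
        by (simp add: sum_fun)
    qed
    finally have "u' (h i) = 0"
      by (rule F.independentD[OF B(3) fin_B subset_refl]) (use h u(1) in \<open>auto simp: bij_betw_def\<close>)
    then show False
      using u(1,2) u' by simp
  qed
  moreover have "s ` {..<m} \<subseteq> {..<n}"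
    using s(1) by blast
  ultimately show thesis
    using that by blast
qed

section \<open>Degrees\<close>

text \<open>The degrees \<open>e\<close> of the generators and the sorted exponents \<open>d\<close>
  list one multiset in different orders. This transfers a selection from the first indexing to the
  second.\<close>

lemma subset_image_mset_mset_setD:
  assumes "N \<subseteq># image_mset f (mset_set S)" "finite S"
  obtains K where "K \<subseteq> S" "N = image_mset f (mset_set K)"
proof -
  have "\<exists>K\<subseteq>S. N = image_mset f (mset_set K)"
    using assms(2,1)
  proof (induction S arbitrary: N rule: finite_induct)
    case (insert x S)
    show ?case
    proof (cases "f x \<in># N")
      case True
      then obtain N' where N': "N = add_mset (f x) N'"
        by (metis mset_add)
      then have "N' \<subseteq># image_mset f (mset_set S)"
        using insert by simp
      then obtain K where K: "K \<subseteq> S" "N' = image_mset f (mset_set K)"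
        using insert.IH by blast
      then have "N = image_mset f (mset_set (insert x K))"
        using N' insert.hyps finite_subset[OF K(1)] by (subst mset_set.insert) auto
      then show ?thesis
        using K(1) by blast
    next
      case False
      have "N \<subseteq># image_mset f (mset_set S)"
      proof (rule mset_subset_eqI)
        fix a
        have "count N a \<le> count (image_mset f (mset_set (insert x S))) a"
          using insert.prems by (rule mset_subset_eq_count)
        then show "count N a \<le> count (image_mset f (mset_set S)) a"
          using False insert.hyps by (cases "a = f x") (auto simp: not_in_iff)
      qed
      then show ?thesis
        using insert.IH by blast
    qed
  qed simp
  then show thesis
    using that by blast
qed

text \<open>An exchange argument: match \<open>K - T\<close> with \<open>T - K\<close>. No value
  decreases under the matching, and the bound on the sums forces every one of these inequalities to
  be an equality.\<close>

lemma image_mset_eq_if_sum_maximal: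
  fixes d :: "nat \<Rightarrow> nat"
  assumes fin: "finite K" "finite T" and card: "card K = card T"
    and top: "\<And>x y. x \<in> K - T \<Longrightarrow> y \<in> T - K \<Longrightarrow> d x \<le> d y"
    and sum: "sum d T \<le> sum d K"
  shows "image_mset d (mset_set K) = image_mset d (mset_set T)"
proof -
  have "card (K - T) = card (T - K)"
    using card fin by (simp add: card_Diff_subset_Int Int_commute)
  then obtain h where h: "bij_betw h (K - T) (T - K)"
    using finite_same_card_bij[of "K - T" "T - K"] fin by blast
  have le: "d x \<le> d (h x)" if "x \<in> K - T" for x
    using top[OF that] h that unfolding bij_betw_def by blast
  have sum_h: "(\<Sum>x\<in>K - T. d (h x)) = sum d (T - K)"
    by (rule sum.reindex_bij_betw[OF h])
  have "sum d K = sum d (K \<inter> T) + sum d (K - T)" "sum d T = sum d (K \<inter> T) + sum d (T - K)"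
    using sum.Int_Diff[OF fin(1), of d T] sum.Int_Diff[OF fin(2), of d K] by (simp_all add: Int_commute)
  then have "(\<Sum>x\<in>K - T. d (h x)) \<le> sum d (K - T)"
    using sum sum_h by simp
  moreover have "sum d (K - T) \<le> (\<Sum>x\<in>K - T. d (h x))"
    by (rule sum_mono) (rule le)
  ultimately have "sum d (K - T) = (\<Sum>x\<in>K - T. d (h x))"
    by simp
  then have eq: "d x = d (h x)" if "x \<in> K - T" for x
    using sum_mono_inv[of d "K - T" "\<lambda>x. d (h x)" x] le fin(1) that by blast
  have "image_mset d (mset_set (T - K)) = image_mset d (image_mset h (mset_set (K - T)))"
    using h by (simp add: bij_betw_def image_mset_mset_set)
  also have "\<dots> = image_mset d (mset_set (K - T))"
    unfolding multiset.map_comp by (rule image_mset_cong) (use eq fin in auto)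
  finally have "image_mset d (mset_set (K \<inter> T)) + image_mset d (mset_set (K - T)) =
      image_mset d (mset_set (K \<inter> T)) + image_mset d (mset_set (T - K))"
    by simp
  moreover have "mset_set K = mset_set (K \<inter> T) + mset_set (K - T)"
    using mset_set_Union[of "K \<inter> T" "K - T"] fin by (simp add: Int_Diff_Un Int_Diff_disjoint)
  moreover have "mset_set T = mset_set (K \<inter> T) + mset_set (T - K)"
    using mset_set_Union[of "T \<inter> K" "T - K"] fin
    by (simp add: Int_Diff_Un Int_Diff_disjoint Int_commute[of K])
  ultimately show ?thesis
    by simp
qed

text \<open>The exponent 1 of \<open>j0\<close> is split off on both sides. The other selected
  degrees correspond to some \<open>K\<close> in \<open>{2..n}\<close>, and among sets of that size
  the final segment has the largest sum because \<open>d\<close> is nondecreasing.\<close>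

lemma top_exponents:
  fixes e d :: "nat \<Rightarrow> nat"
  assumes exps: "image_mset e (mset_set {..<n}) = add_mset 1 (image_mset d (mset_set {2..n}))"
    and mono: "mono_on {2..n} d"
    and J: "J \<subseteq> {..<n}" "card J + k = n" and j0: "j0 \<in> J" "e j0 = 1"
    and sum: "1 + (\<Sum>i = k + 2..n. d i) \<le> sum e J"
  shows "image_mset e (mset_set J) = add_mset 1 (image_mset d (mset_set {k + 2..n}))"
proof -
  have fin: "finite J"
    using J(1) by (rule finite_subset) simp
  have J_split: "mset_set J = add_mset j0 (mset_set (J - {j0}))"
    using mset_set.remove[OF fin j0(1)] .
  have "image_mset e (mset_set J) \<subseteq># image_mset e (mset_set {..<n})"
    by (intro image_mset_subseteq_mono subset_imp_msubset_mset_set) (use J(1) in auto)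
  then have "image_mset e (mset_set (J - {j0})) \<subseteq># image_mset d (mset_set {2..n})"
    unfolding exps J_split using j0(2) by simp
  then obtain K where K: "K \<subseteq> {2..n}" "image_mset e (mset_set (J - {j0})) = image_mset d (mset_set K)"
    by (rule subset_image_mset_mset_setD) simp
  have fin_K: "finite K"
    using K(1) by (rule finite_subset) simp
  have "card K = card (J - {j0})"
    using arg_cong[OF K(2), of size] by simp
  \<comment> \<open>Both sets have \<open>n - k - 1\<close> elements: \<open>J\<close> has
    \<open>n - k\<close>, and one of these is \<open>j0\<close>.\<close>
  then have card: "card K = card {k + 2..n}"
    using J(2) j0(1) fin by simp
  have "sum e (J - {j0}) = sum d K"
    using arg_cong[OF K(2), of sum_mset] by (simp add: sum_unfold_sum_mset)
  then have "sum e J = 1 + sum d K"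
    using fin j0 by (simp add: sum.remove[of J j0])
  then have "sum d {k + 2..n} \<le> sum d K"
    using sum by simp
  then have "image_mset d (mset_set K) = image_mset d (mset_set {k + 2..n})"
  proof (rule image_mset_eq_if_sum_maximal[OF fin_K finite_atLeastAtMost card, rotated])
    fix x y assume xy: "x \<in> K - {k + 2..n}" "y \<in> {k + 2..n} - K"
    then have "x \<in> {2..n}" "y \<in> {2..n}" "x \<le> y"
      using K(1) by auto
    then show "d x \<le> d y"
      using mono by (simp add: mono_on_def)
  qed
  then show ?thesis
    unfolding J_split using K(2) j0(2) by simp
qed

section \<open>Restriction of logarithmic derivations\<close>

text \<open>Assumption \<open>X\<close> expresses that \<open>X\<close> is an intersection of
  hyperplanes. The frame \<open>b\<close> is the one provided by freeness and is unrelated to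
  \<open>x\<close>; the dual functionals mediate between the two.\<close>

locale restriction_frames = formed_arrangement UNIV A \<alpha>
  for A :: "('a::field ^ 'n) set set" and \<alpha> :: "('a ^ 'n) set \<Rightarrow> 'a ^ 'n \<Rightarrow> 'a" +
  fixes X :: "('a ^ 'n) set" and b :: "nat \<Rightarrow> 'a ^ 'n" and \<beta> :: "nat \<Rightarrow> 'a ^ 'n \<Rightarrow> 'a"
    and x :: "nat \<Rightarrow> 'a ^ 'n" and \<xi> :: "nat \<Rightarrow> 'a ^ 'n \<Rightarrow> 'a" and n m :: nat
  assumes X: "\<Inter>{H \<in> A. X \<subseteq> H} \<subseteq> X"
    and n: "vec.dim (UNIV :: ('a ^ 'n) set) = n" and m: "vec.dim X = m"
    and frame_b: "frame UNIV b" and frame_x: "frame X x"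
    and functional_\<beta>: "functional (\<beta> i)" and functional_\<xi>: "functional (\<xi> i)"
    and dual_b: "\<And>i j. i < n \<Longrightarrow> j < n \<Longrightarrow> \<beta> i (b j) = (if i = j then 1 else 0)"
    and dual_x: "\<And>i j. i < m \<Longrightarrow> j < m \<Longrightarrow> \<xi> i (x j) = (if i = j then 1 else 0)"
begin

lemma x_mem: "j < m \<Longrightarrow> x j \<in> X"
  using frame_mem[OF frame_x] m by blast

lemma functional_expand_b:
  assumes \<mu>: "functional \<mu>"
  shows "\<mu> v = (\<Sum>i<n. \<mu> (b i) * \<beta> i v)"
proof -
  have "\<beta> i (b j) = (if i = j then 1 else 0)"
    if "i < vec.dim (UNIV :: ('a ^ 'n) set)" "j < vec.dim (UNIV :: ('a ^ 'n) set)" for i j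
    using that unfolding n by (rule dual_b)
  from functional_eq_on_frame[OF frame_b functional_\<beta> this \<mu> UNIV_I] show ?thesis
    unfolding n .
qed

lemma functional_expand_x:
  assumes \<mu>: "functional \<mu>" and v: "v \<in> X"
  shows "\<mu> v = (\<Sum>j<m. \<mu> (x j) * \<xi> j v)"
proof -
  have "\<xi> i (x j) = (if i = j then 1 else 0)" if "i < vec.dim X" "j < vec.dim X" for i j
    using that unfolding m by (rule dual_x)
  from functional_eq_on_frame[OF frame_x functional_\<xi> this \<mu> v] show ?thesis
    unfolding m .
qed

text \<open>The homomorphism of coordinate rings dual to the inclusion of \<open>X\<close>. The
  default value 0 counts as homogeneous of degree 1, so homogeneity is preserved for all
  polynomials.\<close>

definition restrict :: "'a mpoly \<Rightarrow> 'a mpoly" where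
  "restrict = subst (\<lambda>i. if i < n then linform m (\<lambda>j. \<beta> i (x j)) else 0)"

lemma restrict_mult: "restrict (p * q) = restrict p * restrict q"
  and restrict_sum: "restrict (sum f I) = (\<Sum>i\<in>I. restrict (f i))"
  and restrict_prod: "restrict (prod f I) = (\<Prod>i\<in>I. restrict (f i))"
  and restrict_const: "restrict (const c) = const c"
  and restrict_var: "i < n \<Longrightarrow> restrict (var i) = linform m (\<lambda>j. \<beta> i (x j))"
  by (simp_all add: restrict_def subst_mult subst_sum subst_prod)

lemma restrict_dvd: "p dvd q \<Longrightarrow> restrict p dvd restrict q"
  by (auto simp: dvd_def restrict_mult)

lemma restrict_poly_ring: "p \<in> poly_ring n \<Longrightarrow> restrict p \<in> poly_ring m"
  unfolding restrict_def by (rule subst_poly_ring) auto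

lemma restrict_homogeneous: "homogeneous_poly d p \<Longrightarrow> homogeneous_poly d (restrict p)"
  unfolding restrict_def by (rule homogeneous_subst) (auto intro: homogeneous_linform[simplified])

lemma sum_linforms:
  "(\<Sum>i\<in>I. const (a i) * linform m (c i)) = linform m (\<lambda>j. \<Sum>i\<in>I. a i * c i j)"
  unfolding sum_distrib_left const_sum sum_distrib_right
  by (subst sum.swap) (simp add: const_mult mult.assoc)

lemma restrict_linform:
  assumes "functional \<mu>"
  shows "restrict (linform n (\<lambda>i. \<mu> (b i))) = linform m (\<lambda>j. \<mu> (x j))"
proof -
  have "restrict (linform n (\<lambda>i. \<mu> (b i))) = (\<Sum>i<n. const (\<mu> (b i)) * linform m (\<lambda>j. \<beta> i (x j)))"
    by (simp add: restrict_sum restrict_mult restrict_const restrict_var)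
  also have "\<dots> = linform m (\<lambda>j. \<Sum>i<n. \<mu> (b i) * \<beta> i (x j))"
    by (rule sum_linforms)
  also have "\<dots> = linform m (\<lambda>j. \<mu> (x j))"
    by (simp flip: functional_expand_b[OF assms])
  finally show ?thesis .
qed

text \<open>Restricted to \<open>X\<close>, a logarithmic derivation is tangent to \<open>X\<close>: this is checked
  coefficient by coefficient, each coefficient being a vector lying on all the
  hyperplanes through \<open>X\<close>.\<close>

lemma restrict_tangent:
  assumes f: "logvec n A (coeffs b) f" and \<mu>: "functional \<mu>" "\<And>v. v \<in> X \<Longrightarrow> \<mu> v = 0"
  shows "(\<Sum>i<n. const (\<mu> (b i)) * restrict (f i)) = 0"
proof (rule poly_mapping_eqI)
  fix t
  define w where "w = (\<Sum>i<n. Poly_Mapping.lookup (restrict (f i)) t *s b i)"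
  have w: "Poly_Mapping.lookup (\<Sum>i<n. const (\<nu> (b i)) * restrict (f i)) t = \<nu> w" if "functional \<nu>" for \<nu>
    by (simp add: w_def lookup_sum lookup_const_mult functional_sum[OF that] functional_scale[OF that] mult.commute)
  have "w \<in> H" if H: "H \<in> A" "X \<subseteq> H" for H
  proof -
    have "\<alpha> H (x j) = 0" if "j < m" for j
      using kernel_form[OF H(1)] x_mem[OF that] H(2) by blast
    \<comment> \<open>The form vanishes on \<open>X\<close>, so divisibility by its restriction
      means being zero.\<close>
    then have "restrict (linform n (coeffs b H)) = 0"
      unfolding restrict_linform[OF functional_form[OF H(1)]] by simp
    moreover have "restrict (linform n (coeffs b H)) dvd restrict (\<Sum>i<n. const (coeffs b H i) * f i)"
      using f H(1) by (intro restrict_dvd) (simp add: logvec_def)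
    ultimately have "restrict (\<Sum>i<n. const (coeffs b H i) * f i) = 0"
      by (metis dvd_0_left)
    then have "(\<Sum>i<n. const (\<alpha> H (b i)) * restrict (f i)) = 0"
      by (simp add: restrict_sum restrict_mult restrict_const)
    then have "\<alpha> H w = 0"
      using w[OF functional_form[OF H(1)]] by (metis lookup_zero)
    then show ?thesis
      using kernel_form[OF H(1)] by blast
  qed
  then have "w \<in> X"
    using X by blast
  then show "Poly_Mapping.lookup (\<Sum>i<n. const (\<mu> (b i)) * restrict (f i)) t = Poly_Mapping.lookup 0 t"
    using w[OF \<mu>(1)] \<mu>(2) by simp
qed

text \<open>The coefficients of the restricted derivation in the frame of \<open>X\<close>. Off
  \<open>X\<close> the functional \<open>\<xi> l\<close> is an arbitrary extension; for logarithmic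
  \<open>f\<close> tangency makes the result independent of it.\<close>

definition restrict_vec :: "(nat \<Rightarrow> 'a mpoly) \<Rightarrow> nat \<Rightarrow> 'a mpoly" where
  "restrict_vec f l = (\<Sum>i<n. const (\<xi> l (b i)) * restrict (f i))"

text \<open>On \<open>X\<close>, \<open>\<mu>\<close> agrees with its expansion in the dual
  functionals, so by tangency the difference kills the restricted derivation.\<close>

lemma restrict_vec_apply:
  assumes f: "logvec n A (coeffs b) f" and \<mu>: "functional \<mu>"
  shows "(\<Sum>l<m. const (\<mu> (x l)) * restrict_vec f l) = (\<Sum>i<n. const (\<mu> (b i)) * restrict (f i))"
proof -
  define \<sigma> where "\<sigma> v = (\<Sum>l<m. \<mu> (x l) * \<xi> l v)" for v
  have "functional \<sigma>"
    unfolding \<sigma>_def by (rule functional_sum_mult) (rule functional_\<xi>)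
  then have "functional (\<lambda>v. 1 * \<mu> v + (- 1) * \<sigma> v)"
    by (rule functional_linear_combination[OF \<mu>])
  moreover have "1 * \<mu> v + (- 1) * \<sigma> v = 0" if "v \<in> X" for v
    using functional_expand_x[OF \<mu> that] by (simp add: \<sigma>_def)
  ultimately have "(\<Sum>i<n. const (1 * \<mu> (b i) + (- 1) * \<sigma> (b i)) * restrict (f i)) = 0"
    by (rule restrict_tangent[OF f])
  then have "(\<Sum>i<n. const (\<mu> (b i)) * restrict (f i)) = (\<Sum>i<n. const (\<sigma> (b i)) * restrict (f i))"
    by (simp add: const_diff left_diff_distrib sum_subtractf)
  also have "\<dots> = (\<Sum>l<m. const (\<mu> (x l)) * restrict_vec f l)"
    unfolding restrict_vec_def \<sigma>_def const_sum sum_distrib_left sum_distrib_right const_mult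
    by (subst sum.swap) (simp only: mult.assoc)
  finally show ?thesis ..
qed

lemma restrict_vec_combination:
  assumes "\<And>i. i < n \<Longrightarrow> f i = (\<Sum>j\<in>J. g j * M j i)"
  shows "restrict_vec f l = (\<Sum>j\<in>J. restrict (g j) * restrict_vec (M j) l)"
proof -
  have "restrict_vec f l = (\<Sum>i<n. \<Sum>j\<in>J. restrict (g j) * (const (\<xi> l (b i)) * restrict (M j i)))"
    unfolding restrict_vec_def
    by (intro sum.cong refl) (simp add: assms restrict_sum restrict_mult sum_distrib_left mult.left_commute)
  also have "\<dots> = (\<Sum>j\<in>J. restrict (g j) * restrict_vec (M j) l)"
    unfolding restrict_vec_def sum_distrib_left by (rule sum.swap)
  finally show ?thesis .
qed

lemma restrict_vec_homogeneous:
  "(\<And>i. i < n \<Longrightarrow> homogeneous_poly d (f i)) \<Longrightarrow> homogeneous_poly d (restrict_vec f l)"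
  unfolding restrict_vec_def by (intro homogeneous_sum homogeneous_const_mult restrict_homogeneous) auto

lemma restrict_vec_poly_ring:
  "(\<And>i. i < n \<Longrightarrow> f i \<in> poly_ring n) \<Longrightarrow> restrict_vec f l \<in> poly_ring m"
  unfolding restrict_vec_def by (intro poly_ring_sum poly_ring_mult poly_ring_const restrict_poly_ring) auto

text \<open>Several hyperplanes may cut out the same \<open>Y\<close>; the form of any one of them
  restricts to a defining form of \<open>Y\<close>.\<close>

definition extension :: "('a ^ 'n) set \<Rightarrow> ('a ^ 'n) set" where
  "extension Y = (SOME H. H \<in> A \<and> \<not> X \<subseteq> H \<and> Y = X \<inter> H)"

lemma extension:
  assumes "Y \<in> restriction A X"
  shows "extension Y \<in> A" "\<not> X \<subseteq> extension Y" "Y = X \<inter> extension Y"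
proof -
  have "\<exists>H. H \<in> A \<and> \<not> X \<subseteq> H \<and> Y = X \<inter> H"
    using assms by (auto simp: restriction_def)
  from someI_ex[OF this] show "extension Y \<in> A" "\<not> X \<subseteq> extension Y" "Y = X \<inter> extension Y"
    unfolding extension_def[symmetric] by blast+
qed

lemma formed_restriction: "formed_arrangement X (restriction A X) (\<lambda>Y. \<alpha> (extension Y))"
proof
  have "vec.span (x ` {..<vec.dim X}) = X"
    using frame_x by (simp add: frame_def)
  then show "vec.subspace X"
    by (metis vec.subspace_span)
  have "restriction A X \<subseteq> (\<lambda>H. X \<inter> H) ` A"
    by (auto simp: restriction_def)
  then show "Finite_Set.finite (restriction A X)"
    by (rule finite_subset) (simp add: finite)
  show "defining_form X Y (\<alpha> (extension Y))" if Y: "Y \<in> restriction A X" for Y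
    using kernel_form[OF extension(1)[OF Y]] functional_form[OF extension(1)[OF Y]] extension(3)[OF Y]
    unfolding defining_form_def by blast
  show "Y \<noteq> X" if Y: "Y \<in> restriction A X" for Y
    using extension(2,3)[OF Y] by blast
qed

lemma restrict_vec_logvec:
  assumes f: "logvec n A (coeffs b) f"
  shows "logvec m (restriction A X) (\<lambda>Y i. \<alpha> (extension Y) (x i)) (restrict_vec f)"
  unfolding logvec_def
proof (intro conjI allI impI ballI)
  fix l show "restrict_vec f l \<in> poly_ring m"
    using f unfolding logvec_def by (intro restrict_vec_poly_ring) blast
next
  fix Y assume "Y \<in> restriction A X"
  then have H: "extension Y \<in> A"
    by (rule extension(1))
  note lin = functional_form[OF H]
  have "restrict (linform n (coeffs b (extension Y))) dvd restrict (\<Sum>i<n. const (coeffs b (extension Y) i) * f i)"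
    using f H by (intro restrict_dvd) (simp add: logvec_def)
  then show "linform m (\<lambda>i. \<alpha> (extension Y) (x i)) dvd (\<Sum>j<m. const (\<alpha> (extension Y) (x j)) * restrict_vec f j)"
    unfolding restrict_vec_apply[OF f lin] restrict_linform[OF lin]
    by (simp add: restrict_sum restrict_mult restrict_const)
qed

text \<open>With the variables as coefficients this is the Euler derivation, which maps every linear
  form to itself.\<close>

lemma euler_logvec: "logvec n A (coeffs b) var"
  by (simp add: logvec_def)

lemma restrict_vec_euler: "l < m \<Longrightarrow> restrict_vec var l = var l"
proof -
  assume l: "l < m"
  have "restrict_vec var l = restrict (linform n (\<lambda>i. \<xi> l (b i)))"
    by (simp add: restrict_vec_def restrict_sum restrict_mult restrict_const)
  also have "\<dots> = linform m (\<lambda>j. if l = j then 1 else 0)"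
    unfolding restrict_linform[OF functional_\<xi>] by (intro sum.cong refl) (simp add: dual_x l)
  also have "\<dots> = var l"
    using l by (simp add: if_distrib[of const] if_distrib[of "\<lambda>y. y * _"] cong: if_cong)
  finally show ?thesis .
qed

text \<open>Clearing the forms of the hyperplanes not containing \<open>X\<close> makes every constant derivation in a
  direction of \<open>X\<close> logarithmic, so the restricted derivations have full rank.\<close>

lemma restrict_vec_full:
  assumes l: "l < m"
  obtains f c where "logvec n A (coeffs b) f" "c \<noteq> 0" "\<And>l'. l' < m \<Longrightarrow> restrict_vec f l' = (if l = l' then c else 0)"
proof -
  define P where "P = (\<Prod>H\<in>{H \<in> A. \<not> X \<subseteq> H}. linform n (coeffs b H))"
  define f where "f i = P * const (\<beta> i (x l))" for i
  have sum_f: "(\<Sum>i<n. const (\<mu> (b i)) * f i) = const (\<mu> (x l)) * P" if "functional \<mu>" for \<mu>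
  proof -
    have "(\<Sum>i<n. const (\<mu> (b i)) * f i) = const (\<Sum>i<n. \<mu> (b i) * \<beta> i (x l)) * P"
      unfolding f_def const_sum sum_distrib_right const_mult by (simp add: mult_ac)
    then show ?thesis
      by (simp flip: functional_expand_b[OF that])
  qed
  have "logvec n A (coeffs b) f"
    unfolding logvec_def
  proof (intro conjI allI impI ballI)
    fix i show "f i \<in> poly_ring n"
      unfolding f_def P_def by (intro poly_ring_mult poly_ring_prod poly_ring_const poly_ring_linform)
  next
    fix H assume H: "H \<in> A"
    show "linform n (coeffs b H) dvd (\<Sum>j<n. const (coeffs b H j) * f j)"
      unfolding sum_f[OF functional_form[OF H]]
    proof (cases "X \<subseteq> H")
      case True
      then have "\<alpha> H (x l) = 0"
        using kernel_form[OF H] x_mem[OF l] by blast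
      then show "linform n (coeffs b H) dvd const (\<alpha> H (x l)) * P"
        by simp
    next
      case False
      then have "linform n (coeffs b H) dvd P"
        unfolding P_def using H finite by (intro dvd_prodI) auto
      then show "linform n (coeffs b H) dvd const (\<alpha> H (x l)) * P"
        by (rule dvd_mult)
    qed
  qed
  \<comment> \<open>No factor of \<open>P\<close> vanishes on \<open>X\<close>, and a product of
    nonzero polynomials is nonzero.\<close>
  moreover have "restrict P \<noteq> 0"
  proof
    assume "restrict P = 0"
    then obtain H where H: "H \<in> A" "\<not> X \<subseteq> H" "restrict (linform n (coeffs b H)) = 0"
      unfolding P_def restrict_prod using finite by auto
    then have 0: "\<alpha> H (x j) = 0" if "j < m" for j
      using that unfolding restrict_linform[OF functional_form[OF H(1)]] linform_eq_0_iff by blast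
    have "\<alpha> H v = 0" if "v \<in> X" for v
      using functional_expand_x[OF functional_form[OF H(1)] that] by (simp add: 0)
    then show False
      using kernel_form[OF H(1)] H(2) by blast
  qed
  moreover have "restrict_vec f l' = (if l = l' then restrict P else 0)" if l': "l' < m" for l'
  proof -
    have "restrict_vec f l' = restrict (\<Sum>i<n. const (\<xi> l' (b i)) * f i)"
      by (simp add: restrict_vec_def restrict_sum restrict_mult restrict_const)
    also have "\<dots> = const (\<xi> l' (x l)) * restrict P"
      unfolding sum_f[OF functional_\<xi>] by (simp add: restrict_mult restrict_const)
    finally show ?thesis
      using l l' by (simp add: dual_x)
  qed
  ultimately show thesis
    by (rule that)
qed

end

section \<open>Degrees of the restricted generators against the number of hyperplanes\<close>

theorem theorem1p5:
  fixes A :: "('a::field ^ 'n::finite) set set"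
    and X :: "('a ^ 'n) set"
    and d :: "nat \<Rightarrow> nat"
    and k :: nat
  assumes "arrangement UNIV A"
    and "free_with_exponents UNIV A (add_mset 1 (image_mset d (mset_set {2..CARD('n)})))"
    and "\<forall>i \<in> {2..CARD('n)}. 1 \<le> d i"
    and "mono_on {2..CARD('n)} d"
    and "X \<in> intersection_lattice_rank k A"
  shows "free_with_exponents X (restriction A X)
           (add_mset 1 (image_mset d (mset_set {k + 2..CARD('n)})))
         \<longleftrightarrow> card (restriction A X) = 1 + (\<Sum>i = k + 2..CARD('n). d i)"
proof -
  define n where "n = CARD('n)"
  define m where "m = vec.dim X"
  have dim_UNIV: "vec.dim (UNIV :: ('a ^ 'n) set) = n"
    unfolding n_def by (rule vec_dim_card)
  obtain B where B: "B \<subseteq> A" "X = \<Inter>B" and dim_X: "m + k = n"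
    using assms(5) by (auto simp: intersection_lattice_rank_def intersection_lattice_def m_def n_def)
  have hyperplane: "vec.subspace H" "vec.dim H + 1 = n" if "H \<in> A" for H
    using assms(1) that unfolding arrangement_def dim_UNIV by blast+
  have "\<forall>H. \<exists>\<alpha>. H \<in> A \<longrightarrow> defining_form UNIV H \<alpha>"
  proof
    fix H show "\<exists>\<alpha>. H \<in> A \<longrightarrow> defining_form UNIV H \<alpha>"
    proof (cases "H \<in> A")
      case True
      then obtain \<alpha> where "defining_form UNIV H \<alpha>"
        using hyperplane unfolding n_def by (blast elim: hyperplane_defining_form)
      then show ?thesis
        by blast
    qed blast
  qed
  then obtain \<alpha> where \<alpha>: "\<forall>H. H \<in> A \<longrightarrow> defining_form UNIV H (\<alpha> H)"
    by (rule choice[THEN exE])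
  interpret formed_arrangement UNIV A \<alpha>
  proof
    show "Finite_Set.finite A"
      using assms(1) by (simp add: arrangement_def)
    show "H \<noteq> UNIV" if "H \<in> A" for H
      using hyperplane(2)[OF that] dim_UNIV by (metis Suc_eq_plus1 n_not_Suc_n)
  qed (use \<alpha> in auto)
  obtain b M e where b: "frame UNIV b" and M: "\<And>j. j < n \<Longrightarrow> logvec n A (coeffs b) (M j)"
    and hom: "\<And>j i. j < n \<Longrightarrow> i < n \<Longrightarrow> homogeneous_poly (e j) (M j i)"
    and gen: "\<And>v. logvec n A (coeffs b) v \<Longrightarrow> \<exists>g. \<forall>i<n. v i = (\<Sum>j<n. g j * M j i)"
    and exps: "add_mset 1 (image_mset d (mset_set {2..n})) = image_mset e (mset_set {..<n})"
    by (rule free_with_exponentsE[OF assms(2), unfolded dim_UNIV, folded n_def]) blast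
  have "vec.subspace X"
    unfolding B(2) using B(1) hyperplane(1) by (intro vec.subspace_Inter) blast
  then obtain x where x: "frame X x"
    by (rule frame_exists)
  obtain \<beta> :: "nat \<Rightarrow> 'a ^ 'n \<Rightarrow> 'a" where \<beta>: "\<And>j. functional (\<beta> j)"
    "\<And>j l. j < n \<Longrightarrow> l < n \<Longrightarrow> \<beta> j (b l) = (if j = l then 1 else 0)"
    by (rule dual_frame[OF b, unfolded dim_UNIV]) blast
  obtain \<xi> :: "nat \<Rightarrow> 'a ^ 'n \<Rightarrow> 'a" where \<xi>: "\<And>j. functional (\<xi> j)"
    "\<And>j l. j < m \<Longrightarrow> l < m \<Longrightarrow> \<xi> j (x l) = (if j = l then 1 else 0)"
    by (rule dual_frame[OF x, folded m_def]) blast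
  interpret restriction_frames A \<alpha> X b \<beta> x \<xi> n m
  proof (intro restriction_frames.intro restriction_frames_axioms.intro)
    show "\<Inter>{H \<in> A. X \<subseteq> H} \<subseteq> X"
      using B by blast
  qed (fact formed_arrangement_axioms dim_UNIV m_def[symmetric] b x \<beta> \<xi>)+
  interpret X: formed_arrangement X "restriction A X" "\<lambda>Y. \<alpha> (extension Y)"
    by (rule formed_restriction)
  interpret X: linear_forms m "restriction A X" "X.coeffs x"
    unfolding m_def by (rule X.linear_forms[OF x])
  show ?thesis
    unfolding n_def[symmetric]
  proof
    assume "free_with_exponents X (restriction A X) (add_mset 1 (image_mset d (mset_set {k + 2..n})))"
    from X.free_with_exponents_card(2)[OF this]
    show "card (restriction A X) = 1 + (\<Sum>i = k + 2..n. d i)"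
      by (simp add: sum_unfold_sum_mset)
  next
    assume card: "card (restriction A X) = 1 + (\<Sum>i = k + 2..n. d i)"
    \<comment> \<open>On the zero space the restriction is empty, while the assumed count is at
      least 1.\<close>
    have "0 < m"
    proof (rule ccontr)
      assume "\<not> 0 < m"
      then have "X \<subseteq> {0}"
        unfolding m_def by simp
      then have "X \<subseteq> H" if "H \<in> A" for H
        using vec.subspace_0[OF hyperplane(1)[OF that]] by blast
      then have "restriction A X = {}"
        by (auto simp: restriction_def)
      then show False
        using card by simp
    qed
    define w where "w j = restrict_vec (M j)" for j
    have w_log: "logvec m (restriction A X) (X.coeffs x) (w j)" if "j < n" for j
      unfolding w_def by (rule restrict_vec_logvec[OF M[OF that]])
    have w_hom: "homogeneous_poly (e j) (w j l)" if "j < n" for j l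
      unfolding w_def by (rule restrict_vec_homogeneous) (rule hom[OF that])
    have w_gen: "\<exists>g. \<forall>l<m. restrict_vec f l = (\<Sum>j<n. g j * w j l)" if f: "logvec n A (coeffs b) f" for f
    proof -
      obtain g where g: "\<forall>i<n. f i = (\<Sum>j<n. g j * M j i)"
        using gen[OF f] by blast
      have "restrict_vec f l = (\<Sum>j<n. restrict (g j) * w j l)" for l
        unfolding w_def by (rule restrict_vec_combination) (use g in blast)
      then show ?thesis
        by (intro exI[of _ "\<lambda>j. restrict (g j)"]) simp
    qed
    \<comment> \<open>With exponent 0 excluded, a degree other than 1 is at least 2.\<close>
    have e_pos: "1 \<le> e j" if "j < n" for j
    proof -
      have "e j \<in># image_mset e (mset_set {..<n})"
        using that by simp
      then have "e j \<in># add_mset 1 (image_mset d (mset_set {2..n}))"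
        unfolding exps .
      then show ?thesis
        using assms(3) by (auto simp: n_def)
    qed
    \<comment> \<open>Some generator of degree one survives, since the Euler derivation of \<open>X\<close>, the restriction of
      that of the whole space, is not a combination of derivations of higher degree.\<close>
    have "\<exists>j0<n. e j0 = 1 \<and> (\<exists>l0<m. w j0 l0 \<noteq> 0)"
    proof (rule ccontr)
      assume no: "\<not> ?thesis"
      obtain g where "\<forall>l<m. restrict_vec var l = (\<Sum>j<n. g j * w j l)"
        using w_gen[OF euler_logvec] by blast
      then have "var 0 = (\<Sum>j<n. g j * w j 0)"
        using \<open>0 < m\<close> restrict_vec_euler by metis
      moreover have "order_ge (0 + 2) (\<Sum>j<n. g j * w j 0)"
      proof (intro order_ge_sum order_ge_mult order_ge_zero)
        fix j assume "j \<in> {..<n}"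
        then have j: "j < n"
          by simp
        show "order_ge 2 (w j 0)"
        proof (cases "e j = 1")
          case True
          then show ?thesis
            using no j \<open>0 < m\<close> by auto
        next
          case False
          then have "2 \<le> e j"
            using e_pos[OF j] by simp
          then show ?thesis
            by (rule order_ge_mono[OF homogeneous_imp_order_ge[OF w_hom[OF j]]])
        qed
      qed
      ultimately have "order_ge 2 (var 0 :: 'a mpoly)"
        by (simp only: add_0)
      then have "2 \<le> (1::nat)"
        by (rule homogeneous_order_ge_le[OF homogeneous_var _ var_neq_0])
      then show False
        by simp
    qed
    then obtain j0 l0 where j0: "j0 < n" "e j0 = 1" "l0 < m" "w j0 l0 \<noteq> 0"
      by blast
    have full: "\<exists>c g. c \<noteq> 0 \<and> (\<forall>l'<m. (\<Sum>j<n. g j * w j l') = (if l = l' then c else 0))" if l: "l < m" for l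
    proof -
      obtain f c where f: "logvec n A (coeffs b) f" "c \<noteq> 0"
        "\<And>l'. l' < m \<Longrightarrow> restrict_vec f l' = (if l = l' then c else 0)"
        by (rule restrict_vec_full[OF l]) blast
      obtain g where "\<forall>l'<m. restrict_vec f l' = (\<Sum>j<n. g j * w j l')"
        using w_gen[OF f(1)] by blast
      then have "\<forall>l'<m. (\<Sum>j<n. g j * w j l') = (if l = l' then c else 0)"
        using f(3) by simp
      then show ?thesis
        using f(2) by blast
    qed
    \<comment> \<open>Forcing \<open>j0\<close> into the selection leaves only \<open>m - 1\<close>
      degrees free, which is what the upper bound needs.\<close>
    obtain s where s: "inj_on s {..<m}" "s ` {..<m} \<subseteq> {..<n}" "j0 \<in> s ` {..<m}" "detf m (\<lambda>i. w (s i)) \<noteq> 0"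
      by (rule exists_nonzero_minor[OF full j0(1,3,4)])
    define J where "J = s ` {..<m}"
    have s_less: "s i < n" if "i < m" for i
      using s(2) that by auto
    have sum_e: "(\<Sum>i<m. e (s i)) = sum e J"
      unfolding J_def by (simp add: sum.reindex[OF s(1)])
    have "card (restriction A X) \<le> (\<Sum>i<m. e (s i))"
    proof (rule X.card_le_sum_degrees[of "\<lambda>i. w (s i)"])
      show "logvec m (restriction A X) (X.coeffs x) (w (s i))" if "i < m" for i
        by (rule w_log) (rule s_less[OF that])
      show "homogeneous_poly (e (s i)) (w (s i) j)" if "i < m" for i j
        by (rule w_hom) (rule s_less[OF that])
    qed (rule s(4))
    then have "1 + (\<Sum>i = k + 2..n. d i) \<le> sum e J"
      unfolding card sum_e .
    moreover have "card J + k = n"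
      unfolding J_def card_image[OF s(1)] using dim_X by simp
    ultimately have eq: "image_mset e (mset_set J) = add_mset 1 (image_mset d (mset_set {k + 2..n}))"
      using top_exponents[OF exps[symmetric] assms(4)[folded n_def] _ _ _ j0(2), of J k] s(2,3)
      unfolding J_def by blast
    \<comment> \<open>The identified exponents now sum to the number of hyperplanes, the degree
      condition of Saito's criterion.\<close>
    have "sum e J = card (restriction A X)"
      using arg_cong[OF eq, of sum_mset] by (simp add: sum_unfold_sum_mset card)
    then have "free_with_exponents X (restriction A X) (image_mset (\<lambda>i. e (s i)) (mset_set {..<m}))"
      using X.free_with_exponentsI[OF x, of "\<lambda>i. w (s i)" "\<lambda>i. e (s i)"] w_log w_hom s_less s(4) sum_e
      unfolding m_def by simp
    moreover have "image_mset (\<lambda>i. e (s i)) (mset_set {..<m}) = image_mset e (mset_set J)"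
      unfolding J_def image_mset_mset_set[OF s(1), symmetric] by (simp add: multiset.map_comp comp_def)
    ultimately show "free_with_exponents X (restriction A X) (add_mset 1 (image_mset d (mset_set {k + 2..n})))"
      unfolding eq by simp
  qed
qed

end
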